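(* Let $m,n,a,b,c\in\mathbb Z_{\ge0}$ with $m\ge c$, $n-b+c\ge0$, and put $\alpha:=m-n+b-2c+\varsigma_2$. Assume $\alpha>0$, $\alpha$ is odd, and $b>a+c$. Then in $L(m,n)$ $$B^{(a)}_{1}B^{(b)}_{2}B^{(c)}_{1}\eta=[\alpha]\sum_{\substack{0\le k\le c\\ k\ \mathrm{odd}}}\frac{[\alpha-k+2][\alpha-k+4]\cdots[\alpha+k-2]}{[k]!}\mathfrak{B}^{(a,b-k,c-k)}_{2}+\sum_{\substack{0\le k\le c\\ k\ \mathrm{even}}}\frac{[\alpha-k+1][\alpha-k+3]\cdots[\alpha+k-1]}{[k]!}\mathfrak{B}^{(a,b-k,c-k)}_{2}$$ and $$\mathfrak{B}_{2}^{(a,b,c)}=\sum_{k=0}^{c}(-1)^{k}[\alpha+k-1]\frac{[\alpha+1][\alpha+3]\cdots[\alpha+2k-3]}{[k]!}B_{1}^{(a)}B^{(b-k)}_{2}B^{(c-k)}_{1}\eta.$$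
   Context: Conventions: products written with dots run in steps of $2$ ($[\alpha-k+2]\cdots[\alpha+k-2]$ and $[\alpha+1]\cdots[\alpha+2k-3]$ have $k-1$ factors), and the full coefficient of each $k=0$ term (including the prefactor $[\alpha+k-1]$) is $1$. For $r\in\mathbb Z$: $[r]=\frac{q^r-q^{-r}}{q-q^{-1}}$; $[r]!=[1]\cdots[r]$, $[0]!=1$; $X^{(r)}=X^r/[r]!$ for $r\ge0$ and $X^{(r)}=0$ for $r<0$. $\mathbf U=U_q(\mathfrak{sl}_3)$ is the $\mathbb Q(q)$-algebra generated by $E_i,F_i,K_i^{\pm1}$, $i\in\{1,2\}$, with $K_1K_2=K_2K_1$, $K_iE_jK_i^{-1}=q^{a_{ij}}E_j$, $K_iF_jK_i^{-1}=q^{-a_{ij}}F_j$ ($a_{ii}=2$, $a_{12}=a_{21}=-1$), $E_iF_j-F_jE_i=\delta_{ij}\frac{K_i-K_i^{-1}}{q-q^{-1}}$, and for $i\ne j$ the Serre relations $E_jE_i^{(2)}-E_iE_jE_i+E_i^{(2)}E_j=0$, $F_jF_i^{(2)}-F_iF_jF_i+F_i^{(2)}F_j=0$. $\tau$ swaps $1$ and $2$. The parameter is $\varsigma=(\varsigma_1,\varsigma_2)\in\{(1,0),(0,1)\}$. $\mathbf U^\imath$ is the subalgebra of $\mathbf U$ generated by $B_i=F_i+q^{\varsigma_i}E_{\tau i}K_i^{-1}$, $k_i=K_iK_{\tau i}^{-1}$. $\psi^\imath$ is the $\mathbb Q$-algebra automorphism of $\mathbf U^\imath$ with $q\mapsto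 q^{-1}$, $B_i\mapsto B_i$, $k_i\mapsto k_i^{-1}$. $L(m,n)$ is the simple $\mathbf U$-module of highest weight $m\omega_1+n\omega_2$ with highest weight vector $\eta$; $\psi^\imath$ also denotes the anti-linear involution of $L(m,n)=\mathbf U^\imath\eta$ with $\psi^\imath(u\eta)=\psi^\imath(u)\eta$. iCanonical basis: for $a,b,c\ge0$, $b\ge a+c$ with $F_1^{(a)}F_2^{(b)}F_1^{(c)}\eta\neq0$ (equivalently $c\le m$, $b-c\le n$), $\mathfrak B_2^{(a,b,c)}\in L(m,n)$ is the unique $\psi^\imath$-invariant element of $F_1^{(a)}F_2^{(b)}F_1^{(c)}\eta+\sum_{x,y\ge0,(x,y)\ne(0,0)}q^{-1}\mathbb Z[q^{-1}]F_1^{(a-x)}F_2^{(b-x-y)}F_1^{(c-y)}\eta$. *)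

theory Defs
  imports
    "HOL-Computational_Algebra.Computational_Algebra"
    "HOL-Computational_Algebra.Field_as_Ring"
    "HOL-Library.Poly_Mapping"
begin

hide_const (open) Poly_Mapping.map Poly_Mapping.degree Poly_Mapping.range

section \<open>The ground field and its bar involution\<close>

type_synonym Qq = "rat poly fract"

definition q :: Qq where
  "q = to_fract [:0, 1:]"

definition eval_inv :: "rat poly \<Rightarrow> Qq" where
  "eval_inv p = poly (map_poly (\<lambda>r. to_fract [:r:]) p) (inverse q)"

text \<open>The field automorphism with \<open>q \<mapsto> q^{-1}\<close>: substitute \<open>q^{-1}\<close> in numerator and denominator.\<close>

definition qbar :: "Qq \<Rightarrow> Qq" where
  "qbar x = eval_inv (fst (quot_of_fract x)) / eval_inv (snd (quot_of_fract x))"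

lemma q_nonzero [simp]: "q \<noteq> 0"
  by (simp add: q_def)

lemma eval_inv_0 [simp]: "eval_inv 0 = 0"
  by (simp add: eval_inv_def)

lemma eval_inv_pCons: "eval_inv (pCons r p) = to_fract [:r:] + inverse q * eval_inv p"
  by (simp add: eval_inv_def map_poly_pCons)

lemma eval_inv_1 [simp]: "eval_inv 1 = 1"
  using eval_inv_pCons[of 1 0] by (simp add: one_pCons[symmetric])

lemma eval_inv_add: "eval_inv (p + p') = eval_inv p + eval_inv p'"
  by (induction p p' rule: poly_induct2)
     (simp_all add: eval_inv_pCons algebra_simps to_fract_add[symmetric] del: to_fract_add)

lemma eval_inv_smult: "eval_inv (smult r p) = to_fract [:r:] * eval_inv p"
  by (induction p)
     (simp_all add: eval_inv_pCons algebra_simps to_fract_mult[symmetric] del: to_fract_mult)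

lemma eval_inv_mult: "eval_inv (p * p') = eval_inv p * eval_inv p'"
  by (induction p)
     (simp_all add: eval_inv_pCons eval_inv_add eval_inv_smult algebra_simps)

lemma eval_inv_reflect: "p \<noteq> 0 \<Longrightarrow> to_fract (reflect_poly p) = q ^ degree p * eval_inv p"
proof (induction p)
  case (pCons r p)
  have X: "to_fract (pCons 0 p) = q * to_fract p" for p
    by (simp add: q_def flip: to_fract_mult)
  have pow: "to_fract (monom r n) = to_fract [:r:] * q ^ n" for n
    by (induction n) (simp_all add: monom_0 monom_Suc X)
  show ?case
  proof (cases "p = 0")
    case True
    then show ?thesis by (simp add: eval_inv_pCons)
  next
    case False
    then show ?thesis using pCons.IH
      by (simp add: reflect_poly_pCons' pow eval_inv_pCons algebra_simps)
  qed
qed simp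

lemma eval_inv_nonzero: "p \<noteq> 0 \<Longrightarrow> eval_inv p \<noteq> 0"
  using eval_inv_reflect[of p] by (metis mult_zero_right reflect_poly_0 coeff_0_reflect_poly_0_iff coeff_0 to_fract_eq_0_iff)

lemma qbar_fract:
  assumes "d \<noteq> 0"
  shows "qbar (Fract p d) = eval_inv p / eval_inv d"
proof -
  define p' d' where "p' = fst (quot_of_fract (Fract p d))" and "d' = snd (quot_of_fract (Fract p d))"
  have d': "d' \<noteq> 0" by (simp add: d'_def)
  have "Fract p' d' = Fract p d" by (simp add: p'_def d'_def)
  hence "p' * d = p * d'" using assms d' by (simp add: eq_fract)
  hence "eval_inv p' * eval_inv d = eval_inv p * eval_inv d'"
    by (simp add: eval_inv_mult[symmetric])
  thus ?thesis using eval_inv_nonzero[OF assms] eval_inv_nonzero[OF d']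
    by (simp add: qbar_def p'_def[symmetric] d'_def[symmetric] field_simps)
qed

lemma qbar_1: "qbar 1 = 1"
  by (simp add: qbar_def)

lemma qbar_add: "qbar (x + y) = qbar x + qbar y"
  by (cases x; cases y) (simp add: qbar_fract eval_inv_add eval_inv_mult eval_inv_nonzero field_simps)

lemma qbar_mult: "qbar (x * y) = qbar x * qbar y"
  by (cases x; cases y) (simp add: qbar_fract eval_inv_mult eval_inv_nonzero field_simps)

lemma qbar_q: "qbar q = inverse q"
  by (simp add: qbar_def q_def eval_inv_pCons flip: one_pCons)

definition qint :: "int \<Rightarrow> Qq" where
  "qint r = (q powi r - q powi (- r)) / (q - inverse q)"

definition qfact :: "nat \<Rightarrow> Qq" where
  "qfact r = (\<Prod>i = 1..r. qint (int i))"

definition divpow :: "(Qq \<Rightarrow> 'a \<Rightarrow> 'a) \<Rightarrow> 'a::{ring,monoid_mult} \<Rightarrow> int \<Rightarrow> 'a" where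
  "divpow scale x r = (if r < 0 then 0 else scale (inverse (qfact (nat r))) (x ^ nat r))"

text \<open>\<open>qdots r s\<close> is the product of \<open>[r] [r + 2] \<dots> [s]\<close> in steps of 2, empty for \<open>s < r\<close>.\<close>

definition qdots :: "int \<Rightarrow> int \<Rightarrow> Qq" where
  "qdots r s = (\<Prod>i \<in> {i \<in> {r..s}. even (i - r)}. qint i)"

text \<open>The set \<open>q^{-1} \<int>[q^{-1}]\<close>.\<close>

definition qinv_Z :: "Qq set" where
  "qinv_Z = {inverse q * poly (map_poly of_int p) (inverse q) | p :: int poly. True}"


section \<open>The quantum group of type \<open>A\<^sub>2\<close>\<close>

datatype idx = I1 | I2

fun tau :: "idx \<Rightarrow> idx" where
  "tau I1 = I2"
| "tau I2 = I1"

definition cartan :: "idx \<Rightarrow> idx \<Rightarrow> int" where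
  "cartan i j = (if i = j then 2 else - 1)"

datatype gen = E idx | F idx | K idx | Kinv idx

text \<open>Words form a monoid under concatenation, written additively as \<^typ>\<open>('a, 'b) poly_mapping\<close>
  expects; the free algebra is the monoid algebra of words.\<close>

instantiation list :: (type) monoid_add
begin
definition zero_list :: "'a list" where "zero_list = []"
definition plus_list :: "'a list \<Rightarrow> 'a list \<Rightarrow> 'a list" where "plus_list = append"
instance by standard (simp_all add: zero_list_def plus_list_def)
end

type_synonym free_alg = "gen list \<Rightarrow>\<^sub>0 Qq"

definition fscale :: "Qq \<Rightarrow> free_alg \<Rightarrow> free_alg" where
  "fscale c x = Poly_Mapping.single [] c * x"

definition gn :: "gen \<Rightarrow> free_alg" where
  "gn g = Poly_Mapping.single [g] 1"

inductive_set relators :: "free_alg set" where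
  KKinv: "gn (K i) * gn (Kinv i) - 1 \<in> relators"
| KinvK: "gn (Kinv i) * gn (K i) - 1 \<in> relators"
| KK: "gn (K I1) * gn (K I2) - gn (K I2) * gn (K I1) \<in> relators"
| KE: "gn (K i) * gn (E j) * gn (Kinv i) - fscale (q powi cartan i j) (gn (E j)) \<in> relators"
| KF: "gn (K i) * gn (F j) * gn (Kinv i) - fscale (q powi (- cartan i j)) (gn (F j)) \<in> relators"
| EF: "gn (E i) * gn (F j) - gn (F j) * gn (E i)
        - (if i = j then fscale (1 / (q - inverse q)) (gn (K i) - gn (Kinv i)) else 0) \<in> relators"
| SerreE: "i \<noteq> j \<Longrightarrow>
    gn (E j) * divpow fscale (gn (E i)) 2 - gn (E i) * gn (E j) * gn (E i)
      + divpow fscale (gn (E i)) 2 * gn (E j) \<in> relators"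
| SerreF: "i \<noteq> j \<Longrightarrow>
    gn (F j) * divpow fscale (gn (F i)) 2 - gn (F i) * gn (F j) * gn (F i)
      + divpow fscale (gn (F i)) 2 * gn (F j) \<in> relators"

inductive_set rel_ideal :: "free_alg set" where
  relator: "r \<in> relators \<Longrightarrow> r \<in> rel_ideal"
| zero: "0 \<in> rel_ideal"
| add: "x \<in> rel_ideal \<Longrightarrow> y \<in> rel_ideal \<Longrightarrow> x + y \<in> rel_ideal"
| left: "x \<in> rel_ideal \<Longrightarrow> a * x \<in> rel_ideal"
| right: "x \<in> rel_ideal \<Longrightarrow> x * a \<in> rel_ideal"

lemma rel_ideal_uminus: "x \<in> rel_ideal \<Longrightarrow> - x \<in> rel_ideal"
  using rel_ideal.left[of x "- 1"] by simp

lemma rel_ideal_diff: "x \<in> rel_ideal \<Longrightarrow> y \<in> rel_ideal \<Longrightarrow> x - y \<in> rel_ideal"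
  using rel_ideal.add[of x "- y"] rel_ideal_uminus[of y] by simp

quotient_type uqsl3 = free_alg / "\<lambda>x y. x - y \<in> rel_ideal"
proof (rule equivpI)
  show "reflp (\<lambda>x y. x - y \<in> rel_ideal)"
    by (simp add: reflp_def rel_ideal.zero)
  show "symp (\<lambda>x y. x - y \<in> rel_ideal)"
    by (rule sympI) (use rel_ideal_uminus in fastforce)
  show "transp (\<lambda>x y. x - y \<in> rel_ideal)"
    by (rule transpI) (use rel_ideal.add in fastforce)
qed

text \<open>The counit on the free algebra: it shows that the quotient is not the zero ring.\<close>

definition counit_word :: "gen list \<Rightarrow> Qq" where
  "counit_word w = (if \<forall>g \<in> set w. \<exists>i. g = K i \<or> g = Kinv i then 1 else 0)"

definition counit :: "free_alg \<Rightarrow> Qq" where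
  "counit x = (\<Sum>w \<in> Poly_Mapping.keys x. Poly_Mapping.lookup x w * counit_word w)"

lemma counit_superset:
  "finite S \<Longrightarrow> Poly_Mapping.keys x \<subseteq> S \<Longrightarrow>
    counit x = (\<Sum>w \<in> S. Poly_Mapping.lookup x w * counit_word w)"
  unfolding counit_def by (rule sum.mono_neutral_left) (auto simp: in_keys_iff)

lemma counit_add: "counit (x + y) = counit x + counit y"
proof -
  let ?S = "Poly_Mapping.keys x \<union> Poly_Mapping.keys y"
  have "Poly_Mapping.keys (x + y) \<subseteq> ?S" by (rule keys_add)
  then show ?thesis
    using counit_superset[of ?S x] counit_superset[of ?S y] counit_superset[of ?S "x + y"]
    by (simp add: lookup_add sum.distrib algebra_simps)
qed

lemma counit_0 [simp]: "counit 0 = 0"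
  by (simp add: counit_def)

lemma counit_uminus: "counit (- x) = - counit x"
  using counit_add[of x "- x"] by (simp add: eq_neg_iff_add_eq_0 add.commute)

lemma counit_diff: "counit (x - y) = counit x - counit y"
  using counit_add[of x "- y"] by (simp add: counit_uminus)

lemma counit_single: "counit (Poly_Mapping.single w c) = c * counit_word w"
  by (cases "c = 0") (simp_all add: counit_def)

lemma counit_word_append: "counit_word (u @ v) = counit_word u * counit_word v"
  by (auto simp: counit_word_def)

lemma free_alg_induct [case_names zero single add]:
  fixes x :: free_alg
  assumes "P 0" "\<And>w c. P (Poly_Mapping.single w c)" "\<And>x y. P x \<Longrightarrow> P y \<Longrightarrow> P (x + y)"
  shows "P x"
proof (induction x rule: update_induct)
  case const
  show ?case by (rule assms)
next
  case (update f a b)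
  have "Poly_Mapping.update a b f = f + Poly_Mapping.single a b"
    using update by (intro poly_mapping_eqI)
      (auto simp: lookup_update lookup_add lookup_single in_keys_iff)
  then show ?case using assms update by metis
qed

lemma counit_mult: "counit (x * y) = counit x * counit y"
proof (induction x rule: free_alg_induct)
  case (single w c)
  show ?case
    by (induction y rule: free_alg_induct)
       (simp_all add: mult_single counit_single plus_list_def counit_word_append counit_add
         algebra_simps)
qed (simp_all add: counit_add algebra_simps)

lemma counit_1: "counit 1 = 1"
proof -
  have "counit_word 0 = 1" by (simp add: counit_word_def zero_list_def)
  then show ?thesis using counit_single[of 0 1] by simp
qed

lemma counit_gn: "counit (gn g) = counit_word [g]"
  by (simp add: gn_def counit_single)

lemma counit_fscale: "counit (fscale c x) = c * counit x"
  by (simp add: fscale_def counit_mult counit_single counit_word_def)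

lemma counit_relators: "x \<in> relators \<Longrightarrow> counit x = 0"
  by (induction rule: relators.induct)
     (auto simp: counit_add counit_diff counit_mult counit_1 counit_gn counit_fscale
        counit_word_def divpow_def power2_eq_square)

lemma counit_rel_ideal: "x \<in> rel_ideal \<Longrightarrow> counit x = 0"
  by (induction rule: rel_ideal.induct)
     (simp_all add: counit_relators counit_add counit_mult)

instantiation uqsl3 :: ring_1
begin

lift_definition zero_uqsl3 :: uqsl3 is 0 .
lift_definition one_uqsl3 :: uqsl3 is 1 .

lift_definition plus_uqsl3 :: "uqsl3 \<Rightarrow> uqsl3 \<Rightarrow> uqsl3" is plus
  by (subst add_diff_add) (rule rel_ideal.add)

lift_definition uminus_uqsl3 :: "uqsl3 \<Rightarrow> uqsl3" is uminus
  by (subst minus_diff_minus) (rule rel_ideal_uminus)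

lift_definition minus_uqsl3 :: "uqsl3 \<Rightarrow> uqsl3 \<Rightarrow> uqsl3" is minus
proof -
  fix x x' y y' :: free_alg
  assume "x - x' \<in> rel_ideal" "y - y' \<in> rel_ideal"
  then have "(x - x') - (y - y') \<in> rel_ideal"
    by (rule rel_ideal_diff)
  then show "x - y - (x' - y') \<in> rel_ideal"
    by (simp add: algebra_simps)
qed

lift_definition times_uqsl3 :: "uqsl3 \<Rightarrow> uqsl3 \<Rightarrow> uqsl3" is times
proof -
  fix x x' y y' :: free_alg
  assume "x - x' \<in> rel_ideal" "y - y' \<in> rel_ideal"
  then have "(x - x') * y + x' * (y - y') \<in> rel_ideal"
    by (intro rel_ideal.add rel_ideal.left rel_ideal.right)
  then show "x * y - x' * y' \<in> rel_ideal"
    by (simp add: algebra_simps)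
qed

instance
proof
  show "(0 :: uqsl3) \<noteq> 1"
    by transfer (use counit_rel_ideal[of "0 - 1"] in \<open>auto simp: counit_uminus counit_1\<close>)
qed (transfer, simp add: algebra_simps rel_ideal.zero)+

end

lift_definition uscale :: "Qq \<Rightarrow> uqsl3 \<Rightarrow> uqsl3" (infixr \<open>\<cdot>\<^sub>U\<close> 75) is fscale
  unfolding fscale_def by (subst right_diff_distrib[symmetric]) (rule rel_ideal.left)

lift_definition gen_U :: "gen \<Rightarrow> uqsl3" is gn .

abbreviation udivpow :: "uqsl3 \<Rightarrow> int \<Rightarrow> uqsl3" where
  "udivpow \<equiv> divpow uscale"


section \<open>The coideal subalgebra\<close>

definition B :: "(idx \<Rightarrow> int) \<Rightarrow> idx \<Rightarrow> uqsl3" where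
  "B \<sigma> i = gen_U (F i) + q powi (\<sigma> i) \<cdot>\<^sub>U (gen_U (E (tau i)) * gen_U (Kinv i))"

definition ki :: "idx \<Rightarrow> uqsl3" where
  "ki i = gen_U (K i) * gen_U (Kinv (tau i))"

definition ki_inv :: "idx \<Rightarrow> uqsl3" where
  "ki_inv i = gen_U (K (tau i)) * gen_U (Kinv i)"

inductive_set Ui :: "(idx \<Rightarrow> int) \<Rightarrow> uqsl3 set" for \<sigma> where
  B: "B \<sigma> i \<in> Ui \<sigma>"
| ki: "ki i \<in> Ui \<sigma>"
| one: "1 \<in> Ui \<sigma>"
| add: "x \<in> Ui \<sigma> \<Longrightarrow> y \<in> Ui \<sigma> \<Longrightarrow> x + y \<in> Ui \<sigma>"
| mult: "x \<in> Ui \<sigma> \<Longrightarrow> y \<in> Ui \<sigma> \<Longrightarrow> x * y \<in> Ui \<sigma>"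
| scale: "x \<in> Ui \<sigma> \<Longrightarrow> c \<cdot>\<^sub>U x \<in> Ui \<sigma>"

text \<open>An anti-linear ring automorphism of \<open>Ui\<close> is determined by its values on the generators.
  Only the values of \<open>\<psi>\<close> on \<open>Ui\<close> matter.\<close>

definition is_psi_i :: "(idx \<Rightarrow> int) \<Rightarrow> (uqsl3 \<Rightarrow> uqsl3) \<Rightarrow> bool" where
  "is_psi_i \<sigma> \<psi> \<longleftrightarrow>
     bij_betw \<psi> (Ui \<sigma>) (Ui \<sigma>) \<and>
     \<psi> 1 = 1 \<and>
     (\<forall>x \<in> Ui \<sigma>. \<forall>y \<in> Ui \<sigma>. \<psi> (x + y) = \<psi> x + \<psi> y \<and> \<psi> (x * y) = \<psi> x * \<psi> y) \<and>
     (\<forall>c. \<forall>x \<in> Ui \<sigma>. \<psi> (c \<cdot>\<^sub>U x) = qbar c \<cdot>\<^sub>U \<psi> x) \<and>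
     (\<forall>i. \<psi> (B \<sigma> i) = B \<sigma> i \<and> \<psi> (ki i) = ki_inv i)"


section \<open>The simple highest weight modules\<close>

locale uq_module =
  fixes act :: "uqsl3 \<Rightarrow> 'v::ab_group_add \<Rightarrow> 'v"
  assumes act_add_left: "act (x + y) v = act x v + act y v"
    and act_add_right: "act x (v + w) = act x v + act x w"
    and act_mult: "act (x * y) v = act x (act y v)"
    and act_one: "act 1 v = v"

definition vscale :: "(uqsl3 \<Rightarrow> 'v \<Rightarrow> 'v) \<Rightarrow> Qq \<Rightarrow> 'v \<Rightarrow> 'v" where
  "vscale act c v = act (c \<cdot>\<^sub>U 1) v"

definition submodule :: "(uqsl3 \<Rightarrow> 'v::ab_group_add \<Rightarrow> 'v) \<Rightarrow> 'v set \<Rightarrow> bool" where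
  "submodule act W \<longleftrightarrow> 0 \<in> W \<and> (\<forall>v \<in> W. \<forall>w \<in> W. v + w \<in> W) \<and> (\<forall>u. \<forall>v \<in> W. act u v \<in> W)"

text \<open>\<open>L(m,n)\<close> carried by the whole type \<^typ>\<open>'v\<close>, with highest weight vector \<open>\<eta>\<close>.\<close>

locale L_module = uq_module act for act :: "uqsl3 \<Rightarrow> 'v::ab_group_add \<Rightarrow> 'v" +
  fixes m n :: nat and \<eta> :: 'v
  assumes simple: "submodule act W \<Longrightarrow> W = {0} \<or> W = UNIV"
    and eta_nonzero: "\<eta> \<noteq> 0"
    and E_eta: "act (gen_U (E i)) \<eta> = 0"
    and K1_eta: "act (gen_U (K I1)) \<eta> = vscale act (q ^ m) \<eta>"
    and K2_eta: "act (gen_U (K I2)) \<eta> = vscale act (q ^ n) \<eta>"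

definition is_psi_L ::
    "(idx \<Rightarrow> int) \<Rightarrow> (uqsl3 \<Rightarrow> 'v::ab_group_add \<Rightarrow> 'v) \<Rightarrow> 'v \<Rightarrow> (uqsl3 \<Rightarrow> uqsl3) \<Rightarrow> ('v \<Rightarrow> 'v) \<Rightarrow> bool"
  where
  "is_psi_L \<sigma> act \<eta> \<psi> \<psi>L \<longleftrightarrow>
     (\<forall>v w. \<psi>L (v + w) = \<psi>L v + \<psi>L w) \<and>
     (\<forall>c v. \<psi>L (vscale act c v) = vscale act (qbar c) (\<psi>L v)) \<and>
     (\<forall>v. \<psi>L (\<psi>L v) = v) \<and>
     (\<forall>u \<in> Ui \<sigma>. \<psi>L (act u \<eta>) = act (\<psi> u) \<eta>)"


section \<open>The i-canonical basis\<close>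

definition Fmon :: "(uqsl3 \<Rightarrow> 'v \<Rightarrow> 'v) \<Rightarrow> 'v \<Rightarrow> int \<Rightarrow> int \<Rightarrow> int \<Rightarrow> 'v" where
  "Fmon act \<eta> a b c =
     act (udivpow (gen_U (F I1)) a * udivpow (gen_U (F I2)) b * udivpow (gen_U (F I1)) c) \<eta>"

definition Bmon :: "(idx \<Rightarrow> int) \<Rightarrow> (uqsl3 \<Rightarrow> 'v \<Rightarrow> 'v) \<Rightarrow> 'v \<Rightarrow> int \<Rightarrow> int \<Rightarrow> int \<Rightarrow> 'v" where
  "Bmon \<sigma> act \<eta> a b c =
     act (udivpow (B \<sigma> I1) a * udivpow (B \<sigma> I2) b * udivpow (B \<sigma> I1) c) \<eta>"

text \<open>Arbitrary finite index sets are allowed: terms with a negative exponent vanish by the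
  convention built into \<open>divpow\<close>.\<close>

definition icb2_coset ::
    "(uqsl3 \<Rightarrow> 'v::ab_group_add \<Rightarrow> 'v) \<Rightarrow> 'v \<Rightarrow> int \<Rightarrow> int \<Rightarrow> int \<Rightarrow> 'v set" where
  "icb2_coset act \<eta> a b c =
     {Fmon act \<eta> a b c
        + (\<Sum>(x, y) \<in> S. vscale act (p x y) (Fmon act \<eta> (a - int x) (b - int x - int y) (c - int y)))
      | (S :: (nat \<times> nat) set) p.
        finite S \<and> (0, 0) \<notin> S \<and> (\<forall>(x, y) \<in> S. p x y \<in> qinv_Z)}"

text \<open>Only meaningful for \<open>a, b, c \<ge> 0\<close>, \<open>b \<ge> a + c\<close>, \<open>c \<le> m\<close> and \<open>b - c \<le> n\<close>, where the
  element described exists uniquely.\<close>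

definition icb2 ::
    "(uqsl3 \<Rightarrow> 'v::ab_group_add \<Rightarrow> 'v) \<Rightarrow> 'v \<Rightarrow> ('v \<Rightarrow> 'v) \<Rightarrow> int \<Rightarrow> int \<Rightarrow> int \<Rightarrow> 'v" where
  "icb2 act \<eta> \<psi>L a b c = (THE v. v \<in> icb2_coset act \<eta> a b c \<and> \<psi>L v = v)"

end

theory Submission
  imports Defs
begin

text \<open>Write \<open>M = m - c\<close>. Expanding \<open>(F + q\<^sup>x E K\<^sup>-\<^sup>1)\<^sup>(\<^sup>a\<^sup>)\<close> twice gives the monomial
  \<open>B\<^sub>1\<^sup>(\<^sup>a\<^sup>) B\<^sub>2\<^sup>(\<^sup>b\<^sup>) B\<^sub>1\<^sup>(\<^sup>c\<^sup>) \<eta>\<close> as a combination of \<open>F\<^sub>1\<^sup>(\<^sup>a\<^sup>-\<^sup>i\<^sup>) F\<^sub>2\<^sup>(\<^sup>b\<^sup>-\<^sup>i\<^sup>-\<^sup>j\<^sup>) F\<^sub>1\<^sup>(\<^sup>c\<^sup>-\<^sup>j\<^sup>) \<eta>\<close> whose coefficient is a factor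
  depending on \<open>i\<close>, \<open>j\<close> times a factor depending on \<open>j\<close>, \<open>\<alpha>\<close>, \<open>M\<close>. The first factor is unchanged when
  \<open>(b, c)\<close> is replaced by \<open>(b - k, c - k)\<close> and \<open>j\<close> by \<open>j - k\<close>, and it lies in \<open>q\<^sup>-\<^sup>1 \<int>[q\<^sup>-\<^sup>1]\<close> for \<open>i > 0\<close> because
  \<open>\<alpha> > 0\<close> and \<open>b > a + c\<close>. So everything reduces to one-variable identities in \<open>j\<close>. As functions of
  \<open>M\<close> both sides satisfy the same Pascal-type recurrence, whose increments are in \<open>q\<^sup>-\<^sup>1 \<int>[q\<^sup>-\<^sup>1]\<close>;
  \<open>n - b + c \<ge> 0\<close> implies \<open>M \<ge> \<alpha> - 1\<close>, and at \<open>M = \<alpha> - 1\<close> the sums telescope to products. The shift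
  \<open>c \<mapsto> c - k\<close> changes \<open>\<alpha>\<close> to \<open>\<alpha> + k\<close>, so the case of even \<open>\<alpha>\<close> has to be treated along the way.

  Uniqueness of the bar-invariant element needs linear independence of the \<open>F\<close>-monomials, obtained
  by applying \<open>E\<^sub>1 E\<^sub>2\<close> and \<open>E\<^sub>2 E\<^sub>1\<close> to a linear relation.\<close>


section \<open>Quantum integers\<close>

text \<open>\<open>q\<close> is the indeterminate, so its powers are told apart by the degree of a
  monomial. Every division by a quantum integer rests on this.\<close>

lemma q_power_eq_1_iff: "q ^ n = 1 \<longleftrightarrow> n = 0"
proof
  have q_power: "q ^ n = to_fract (monom 1 n)" for n
    by (induction n) (simp_all add: q_def monom_Suc monom_0 flip: to_fract_mult one_pCons)
  assume "q ^ n = 1"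
  then have "monom (1::rat) n = 1"
    unfolding q_power by (metis to_fract_1 to_fract_eq_iff)
  then have "degree (monom (1::rat) n) = degree (1 :: rat poly)" by simp
  then show "n = 0" by (simp add: degree_monom_eq)
qed simp

lemma q_powi_eq_1_iff: "q powi k = 1 \<longleftrightarrow> k = 0"
proof (cases "k \<ge> 0")
  case True
  then show ?thesis using q_power_eq_1_iff[of "nat k"] by (simp add: power_int_def)
next
  case False
  then show ?thesis using q_power_eq_1_iff[of "nat (- k)"] by (simp add: power_int_def power_inverse)
qed

lemma q_powi_inj: "q powi k = q powi l \<Longrightarrow> k = l"
  using q_powi_eq_1_iff[of "k - l"] by (simp add: power_int_diff)

lemma q_powi_mult: "q powi x * q powi y = q powi (x + y)"
  by (simp add: power_int_add)

lemma q_powi_mult_left: "q powi x * (q powi y * z) = q powi (x + y) * z"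
  by (simp add: power_int_add)

lemma q_minus_inverse_nonzero: "q - inverse q \<noteq> 0"
proof
  assume "q - inverse q = 0"
  then have "q powi 1 = q powi (-1)" by (simp add: power_int_minus)
  then show False using q_powi_inj by fastforce
qed

lemma qint_nonzero [simp]: "r \<noteq> 0 \<Longrightarrow> qint r \<noteq> 0"
  using q_minus_inverse_nonzero q_powi_inj[of r "- r"] by (auto simp: qint_def)

lemma qint_0 [simp]: "qint 0 = 0"
  by (simp add: qint_def)

lemma qint_1 [simp]: "qint 1 = 1"
  using q_minus_inverse_nonzero by (simp add: qint_def power_int_minus)

lemma qint_add: "qint (x + y) = q powi y * qint x + q powi (- x) * qint y"
  by (simp add: qint_def diff_divide_distrib right_diff_distrib q_powi_mult add.commute)

lemma qint_add': "qint (x + y) = q powi (- y) * qint x + q powi x * qint y"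
  using qint_add[of y x] by (simp add: add.commute)

lemma qfact_0 [simp]: "qfact 0 = 1"
  by (simp add: qfact_def)

lemma qfact_Suc [simp]: "qfact (Suc n) = qint (1 + int n) * qfact n"
  by (simp add: qfact_def atLeastAtMostSuc_conv)

lemma qfact_nonzero [simp]: "qfact n \<noteq> 0"
  by (induction n) simp_all

section \<open>Rising products in steps of 1 and 2\<close>

definition qrise :: "int \<Rightarrow> nat \<Rightarrow> Qq" where
  "qrise x n = (\<Prod>i<n. qint (x + int i))"

definition qrise2 :: "int \<Rightarrow> nat \<Rightarrow> Qq" where
  "qrise2 x n = (\<Prod>i<n. qint (x + 2 * int i))"

lemma qrise_0 [simp]: "qrise x 0 = 1"
  by (simp add: qrise_def)

lemma qrise_Suc: "qrise x (Suc n) = qrise x n * qint (x + int n)"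
  by (simp add: qrise_def)

lemma qrise_Suc_left: "qrise x (Suc n) = qint x * qrise (x + 1) n"
  by (simp add: qrise_def prod.lessThan_Suc_shift algebra_simps del: prod.lessThan_Suc)

lemma qrise2_0 [simp]: "qrise2 x 0 = 1"
  by (simp add: qrise2_def)

lemma qrise2_Suc: "qrise2 x (Suc n) = qrise2 x n * qint (x + 2 * int n)"
  by (simp add: qrise2_def)

lemma qrise2_Suc_left: "qrise2 x (Suc n) = qint x * qrise2 (x + 2) n"
  by (simp add: qrise2_def prod.lessThan_Suc_shift algebra_simps del: prod.lessThan_Suc)

lemma qrise2_add: "qrise2 x (k + n) = qrise2 x k * qrise2 (x + 2 * int k) n"
  by (induction n) (simp_all add: qrise2_Suc algebra_simps)

text \<open>Translates dotted products, given by their end points, into products of known length;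
  the empty product has upper end \<open>r - 2\<close>.\<close>

lemma qdots_eq_qrise2: "qdots r (r + 2 * int n - 2) = qrise2 r n"
proof -
  have "{i \<in> {r..r + 2 * int n - 2}. even (i - r)} = (\<lambda>i. r + 2 * int i) ` {..<n}" (is "?A = ?B")
  proof
    show "?A \<subseteq> ?B"
    proof
      fix i assume i: "i \<in> ?A"
      then have "i = r + 2 * int (nat ((i - r) div 2))" "nat ((i - r) div 2) < n" by auto
      then show "i \<in> ?B" by blast
    qed
  qed auto
  then show ?thesis
    by (simp add: qdots_def qrise2_def prod.reindex inj_on_def)
qed

lemma Suc_choose_2: "Suc n choose 2 = n + (n choose 2)"
  by (simp add: numeral_2_eq_2)

section \<open>Two terminating sums\<close>

text \<open>At \<open>M = \<alpha> - 1\<close> the \<open>F\<close>-coefficients of the candidate for the i-canonical basis are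
  \<open>\<Sum>k. wterm \<alpha> j k\<close> for even \<open>\<alpha>\<close> and \<open>[\<alpha> + j - 1] \<Sum>k. hterm (\<alpha> - 1) j k\<close> for odd \<open>\<alpha>\<close>. Both are multiples of
  sums of \<open>hterm\<close>; splitting off the factor avoids a division by \<open>[\<alpha> - 1]\<close>, which vanishes for \<open>\<alpha> = 1\<close>.\<close>

definition wterm :: "int \<Rightarrow> nat \<Rightarrow> nat \<Rightarrow> Qq" where
  "wterm \<beta> j k = (- 1) ^ k * qrise2 \<beta> k / qfact k * q powi (- int ((j - k) choose 2))
     * qrise (\<beta> + int k) (j - k) / qfact (j - k)"

definition hterm :: "int \<Rightarrow> nat \<Rightarrow> nat \<Rightarrow> Qq" where
  "hterm \<beta> j k = (- 1) ^ k
     * (if k = 0 then qrise (\<beta> + 1) (j - 1) else qrise2 (\<beta> + 2) (k - 1) * qrise (\<beta> + int k) (j - k))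
     / qfact k * q powi (- int ((j - k) choose 2)) / qfact (j - k)"

text \<open>The telescoping certificate is \<open>[k] q^(k-j) hterm \<beta> j k\<close>. Splitting
  \<open>[j]\<close> along \<open>k + (j - k)\<close> and \<open>[\<beta> + 2k]\<close>, a factor of
  the next term, along \<open>(\<beta> + k) + k\<close> cancels all but one summand; the survivor is
  a term of the sum for \<open>j - 2\<close> and \<open>\<beta> + 2\<close>.\<close>

lemma hterm_telescope:
  assumes "k < j"
  shows "qint (int j) * hterm \<beta> j k
      - q powi (1 - \<beta> - int j) * (if k = 0 then 0 else wterm (\<beta> + 2) (j - 2) (k - 1))
    = qint (int k) * q powi (int k - int j) * hterm \<beta> j k
      - qint (int (Suc k)) * q powi (int (Suc k) - int j) * hterm \<beta> j (Suc k)"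
proof (cases k)
  case 0
  then obtain d where j: "j = Suc d" using assms by (cases j) auto
  show ?thesis
    by (simp add: 0 j hterm_def Suc_choose_2 q_powi_mult_left q_powi_mult algebra_simps)
next
  case (Suc k')
  obtain d where j: "j = Suc k' + Suc d"
    using assms Suc by (metis add_Suc_right less_imp_Suc_add)
  \<comment> \<open>\<open>C\<close> is the surviving \<open>wterm\<close>; both neighbouring values
    of \<open>hterm\<close> are simple multiples of it.\<close>
  define C where "C = (- 1) ^ k' * qrise2 (\<beta> + 2) k' * qrise (\<beta> + int k + 1) d
    * q powi (- int (d choose 2)) / (qfact k' * qfact d)"
  have h: "hterm \<beta> j k = - C * qint (\<beta> + int k) * q powi (- int d) / (qint (int k) * qint (1 + int d))"
  proof -
    have "q powi (- int (Suc d choose 2)) = q powi (- int (d choose 2)) * q powi (- int d)"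
      by (simp add: Suc_choose_2 q_powi_mult algebra_simps)
    then show ?thesis
      by (simp add: hterm_def C_def j Suc qrise_Suc_left algebra_simps)
  qed
  have h': "hterm \<beta> j (Suc k) = C * qint (\<beta> + 2 * int k) / (qint (int k) * qint (1 + int k))"
    by (simp add: hterm_def C_def j Suc qrise2_Suc algebra_simps)
  have w: "wterm (\<beta> + 2) (j - 2) (k - 1) = C"
    by (simp add: wterm_def C_def j Suc algebra_simps)
  have nz: "qint (int k) \<noteq> 0" "qint (1 + int d) \<noteq> 0" "qint (1 + int k) \<noteq> 0"
    using Suc by (auto intro!: qint_nonzero)
  have j': "qint (int j) = q powi (- (1 + int d)) * qint (int k) + q powi (int k) * qint (1 + int d)"
    using qint_add'[of "int k" "1 + int d"] by (simp add: j Suc algebra_simps)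
  have b: "qint (\<beta> + 2 * int k) = q powi (int k) * qint (\<beta> + int k) + q powi (- \<beta> - int k) * qint (int k)"
    using qint_add[of "\<beta> + int k" "int k"] by (simp add: algebra_simps)
  have e: "int k - int j = - 1 - int d" "1 + int k - int j = - int d"
    "1 - \<beta> - int j = - int d + (- \<beta> - int k)" "int (Suc k) = 1 + int k" "- (1 + int d) = - 1 - int d"
    by (simp_all add: j Suc)
  have sp: "q powi (- int d + (- \<beta> - int k)) = q powi (- int d) * q powi (- \<beta> - int k)"
    by (simp add: q_powi_mult)
  show ?thesis
    unfolding h h' w j' b e sp using nz Suc
    by (simp add: divide_simps) (simp add: algebra_simps)
qed

definition hsum :: "nat \<Rightarrow> int \<Rightarrow> Qq" where
  "hsum j \<beta> = (\<Sum>k\<le>j. hterm \<beta> j k)"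

text \<open>In the telescoped sum over \<open>k < j\<close> the lower end vanishes through
  \<open>[0]\<close>, and the upper end supplies the missing term \<open>k = j\<close>. As
  \<open>wterm\<close> is a multiple of \<open>hterm\<close> for positive index, this becomes a
  recursion lowering \<open>j\<close> by 2.\<close>

lemma hsum_rec:
  assumes "j \<ge> 2"
  shows "qint (int j) * hsum j \<beta> = q powi (1 - \<beta> - int j) * (\<Sum>k\<le>j - 2. wterm (\<beta> + 2) (j - 2) k)"
proof -
  let ?w = "\<lambda>k. if k = 0 then 0 else wterm (\<beta> + 2) (j - 2) (k - 1)"
  let ?G = "\<lambda>k. qint (int k) * q powi (int k - int j) * hterm \<beta> j k"
  have "(\<Sum>k<j. qint (int j) * hterm \<beta> j k - q powi (1 - \<beta> - int j) * ?w k) = (\<Sum>k<j. ?G k - ?G (Suc k))"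
    by (rule sum.cong) (simp_all only: hterm_telescope lessThan_iff)
  also have "\<dots> = ?G 0 - ?G j"
    by (rule sum_lessThan_telescope')
  finally have "qint (int j) * (\<Sum>k<j. hterm \<beta> j k) - q powi (1 - \<beta> - int j) * (\<Sum>k<j. ?w k)
      = - qint (int j) * hterm \<beta> j j"
    by (simp add: sum_subtractf sum_distrib_left)
  moreover have "(\<Sum>k<j. ?w k) = (\<Sum>k\<le>j - 2. wterm (\<beta> + 2) (j - 2) k)"
  proof -
    obtain i where j: "j = Suc (Suc i)" using assms by (metis add_2_eq_Suc le_Suc_ex)
    show ?thesis unfolding j by (subst sum.lessThan_Suc_shift) (simp add: lessThan_Suc_atMost)
  qed
  ultimately show ?thesis
    by (simp add: hsum_def lessThan_Suc_atMost[symmetric] algebra_simps)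
qed

lemma hsum_1: "hsum 1 \<beta> = 0"
  by (simp add: hsum_def hterm_def numeral_2_eq_2)

lemma wterm_hterm: "j \<ge> 1 \<Longrightarrow> wterm \<beta> j k = qint \<beta> * hterm \<beta> j k"
proof -
  assume "j \<ge> 1"
  then obtain i where "j = Suc i" by (cases j) auto
  then show ?thesis
    by (cases k) (simp_all add: wterm_def hterm_def qrise_Suc_left qrise2_Suc_left)
qed

lemma sum_wterm: "j \<ge> 1 \<Longrightarrow> (\<Sum>k\<le>j. wterm \<beta> j k) = qint \<beta> * hsum j \<beta>"
  by (simp add: hsum_def sum_distrib_left wterm_hterm)

definition qdfact :: "nat \<Rightarrow> Qq" where
  "qdfact s = (\<Prod>i=1..s. qint (2 * int i))"

lemma qdfact_0 [simp]: "qdfact 0 = 1"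
  by (simp add: qdfact_def)

lemma qdfact_Suc [simp]: "qdfact (Suc s) = qint (2 + 2 * int s) * qdfact s"
  by (simp add: qdfact_def atLeastAtMostSuc_conv algebra_simps)

lemma qdfact_nonzero [simp]: "qdfact s \<noteq> 0"
  by (induction s) (simp_all)

lemma hsum_odd: "odd j \<Longrightarrow> hsum j \<beta> = 0"
proof (induction j arbitrary: \<beta> rule: less_induct)
  case (less j)
  show ?case
  proof (cases "j = 1")
    case True
    then show ?thesis by (simp only: hsum_1)
  next
    case False
    then have j: "j \<ge> 3" using less.prems by (metis One_nat_def Suc_leI le_neq_implies_less less_2_cases_iff not_less numeral_2_eq_2 numeral_3_eq_3 odd_pos even_numeral)
    then have "hsum (j - 2) (\<beta> + 2) = 0" using less by auto
    then have "qint (int j) * hsum j \<beta> = 0"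
      using j by (simp add: hsum_rec sum_wterm)
    then show ?thesis using j by (simp add: mult_eq_0_iff)
  qed
qed

text \<open>The descent in steps of 2 ends at \<open>hsum 2\<close>, which is computed directly
  because pulling \<open>[\<beta>]\<close> out of \<open>wterm\<close> needs
  \<open>j \<ge> 1\<close>.\<close>

lemma hsum_even: "hsum (2 * Suc s) \<beta> = q powi (int (Suc s) * (1 - \<beta> - 2 * int (Suc s))) * qrise2 (\<beta> + 2) s / qdfact (Suc s)"
proof (induction s arbitrary: \<beta>)
  case 0
  have "qint 2 * hsum 2 \<beta> = q powi (1 - \<beta> - 2)"
    using hsum_rec[of 2 \<beta>] by (simp add: wterm_def numeral_2_eq_2)
  then show ?case by (simp add: field_simps numeral_2_eq_2)
next
  case (Suc s)
  let ?j = "2 * Suc (Suc s)"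
  have "qint (int ?j) * hsum ?j \<beta> = q powi (1 - \<beta> - int ?j) * (qint (\<beta> + 2) * hsum (2 * Suc s) (\<beta> + 2))"
  proof -
    have e: "?j - 2 = 2 * Suc s" and 2: "2 \<le> ?j" "1 \<le> 2 * Suc s" by auto
    show ?thesis using hsum_rec[OF 2(1), of \<beta>] unfolding e sum_wterm[OF 2(2)] .
  qed
  also have "\<dots> = q powi (int (Suc (Suc s)) * (1 - \<beta> - 2 * int (Suc (Suc s)))) * qrise2 (\<beta> + 2) (Suc s) / qdfact (Suc s)"
  proof -
    have e: "int (Suc (Suc s)) * (1 - \<beta> - 2 * int (Suc (Suc s)))
      = (1 - \<beta> - int ?j) + int (Suc s) * (1 - (\<beta> + 2) - 2 * int (Suc s))"
      by (simp add: algebra_simps)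
    show ?thesis unfolding Suc.IH e q_powi_mult[symmetric]
      by (simp add: qrise2_Suc_left algebra_simps)
  qed
  finally have "hsum ?j \<beta> = q powi (int (Suc (Suc s)) * (1 - \<beta> - 2 * int (Suc (Suc s)))) * qrise2 (\<beta> + 2) (Suc s) / (qdfact (Suc s) * qint (int ?j))"
    by (simp add: field_simps)
  moreover have "qdfact (Suc s) * qint (int ?j) = qdfact (Suc (Suc s))"
    by (simp add: algebra_simps)
  ultimately show ?case by simp
qed

text \<open>At M = \<alpha> - 1 this is, up to a factor independent of \<open>s\<close>, the summand
  with index \<open>2 * s\<close> in the expansion of \<open>BF_coef\<close> by
  \<open>icbF_coef\<close>. It is cut off at \<open>2 * s > j\<close> so that boundary terms of the
  telescoping vanish by definition.\<close>

definition nterm :: "int \<Rightarrow> nat \<Rightarrow> nat \<Rightarrow> Qq" where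
  "nterm \<alpha> j s = (if 2 * s \<le> j then q powi (int s * (1 - \<alpha> - int j))
     * qrise2 (\<alpha> - int j + 2 * int s + 2) (j - s - 1) / (qfact (j - 2 * s) * qdfact s) else 0)"

text \<open>Here the certificate is \<open>q^(j+1-2s) [2s] nterm \<alpha> (j+1) s\<close>. With
  \<open>y = j - 2s\<close>, \<open>[j + 1]\<close> is split along \<open>(1 + y) + 2s\<close> and
  \<open>[\<alpha> + 1]\<close> along \<open>X + y\<close>; the degenerate cases
  \<open>2s > j\<close> are checked apart.\<close>

lemma nterm_telescope:
  assumes "j \<ge> 1"
  shows "qint (int (Suc j)) * nterm \<alpha> (Suc j) s - q powi (- int j) * qint (\<alpha> + 1) * nterm (\<alpha> + 1) j s
    = q powi (int (Suc j) - 2 * int s) * qint (2 * int s) * nterm \<alpha> (Suc j) s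
    - q powi (int (Suc j) - 2 * int (Suc s)) * qint (2 * int (Suc s)) * nterm \<alpha> (Suc j) (Suc s)"
proof -
  consider "2 * s > Suc j" | "2 * s = Suc j" | "2 * s \<le> j" by linarith
  then show ?thesis
  proof cases
    case 1
    then show ?thesis by (simp add: nterm_def)
  next
    case 2
    then have "2 * int s = int (Suc j)" by (metis of_nat_mult of_nat_numeral)
    with 2 show ?thesis by (simp add: nterm_def)
  next
    case 3
    then obtain y where j: "j = 2 * s + y" by (metis le_Suc_ex)
    define X where "X = \<alpha> - int j + 2 * int s + 1"
    \<comment> \<open>\<open>C\<close> is \<open>nterm (\<alpha> + 1) j s\<close>; the terms for
      \<open>j + 1\<close> at \<open>s\<close> and \<open>s + 1\<close> are multiples of it.\<close>
    define C where "C = q powi (int s * (- \<alpha> - int j)) * qrise2 (X + 2) (j - s - 1) / (qfact y * qdfact s)"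
    have jn: "j - s = Suc (j - s - 1)" using assms j by simp
    have t1: "nterm \<alpha> (Suc j) s = C * qint X / qint (1 + int y)"
    proof -
      have "Suc j - 2 * s = Suc y" "Suc j - s - 1 = j - s" using j by auto
      moreover have "\<alpha> - int (Suc j) + 2 * int s + 2 = X" "1 - \<alpha> - int (Suc j) = - \<alpha> - int j" by (simp_all add: X_def)
      moreover have "qrise2 X (j - s) = qint X * qrise2 (X + 2) (j - s - 1)" by (metis jn qrise2_Suc_left)
      ultimately show ?thesis using 3 by (simp add: nterm_def C_def mult.commute mult.left_commute)
    qed
    have t2: "nterm (\<alpha> + 1) j s = C"
    proof -
      have e: "\<alpha> + 1 - int j + 2 * int s + 2 = X + 2" "1 - (\<alpha> + 1) - int j = - \<alpha> - int j"
        and "j - 2 * s = y" using j by (auto simp add: X_def)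
      then show ?thesis using 3 unfolding nterm_def e C_def by simp
    qed
    have t3: "qint (2 * int (Suc s)) * nterm \<alpha> (Suc j) (Suc s) = q powi (- \<alpha> - int j) * qint (int y) * C"
    proof (cases "y = 0")
      case True
      then show ?thesis using j by (simp add: nterm_def)
    next
      case False
      then obtain y' where y: "y = Suc y'" by (cases y) auto
      have "Suc j - 2 * Suc s = y'" "Suc j - Suc s - 1 = j - s - 1" "2 * Suc s \<le> Suc j" using j y by auto
      moreover have "\<alpha> - int (Suc j) + 2 * int (Suc s) + 2 = X + 2" "1 - \<alpha> - int (Suc j) = - \<alpha> - int j" by (simp_all add: X_def)
      moreover have "q powi (int (Suc s) * (- \<alpha> - int j)) = q powi (- \<alpha> - int j) * q powi (int s * (- \<alpha> - int j))"
        by (simp add: q_powi_mult algebra_simps)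
      moreover have "qint (1 + int y') \<noteq> 0" "qint (2 + 2 * int s) \<noteq> 0" by (auto intro!: qint_nonzero)
      ultimately show ?thesis by (simp add: nterm_def C_def y)
    qed
    have nz: "qint (1 + int y) \<noteq> 0" by (auto intro!: qint_nonzero)
    have a: "qint (\<alpha> + 1) = q powi (int y) * qint X + q powi (- X) * qint (int y)"
      using qint_add[of X "int y"] by (simp add: X_def j)
    have b: "qint (int (Suc j)) = q powi (- 2 * int s) * qint (1 + int y) + q powi (1 + int y) * qint (2 * int s)"
      using qint_add'[of "1 + int y" "2 * int s"] by (simp add: j algebra_simps)
    have e: "int (Suc j) - 2 * int s = 1 + int y" "int (Suc j) - 2 * int (Suc s) = int y - 1"
      by (simp_all add: j)
    have "q powi (- int j) * q powi (int y) = q powi (- 2 * int s)"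
      "q powi (- int j) * q powi (- X) = q powi (int y - 1) * q powi (- \<alpha> - int j)"
      unfolding q_powi_mult by (rule arg_cong[where f = "\<lambda>x. q powi x"], simp add: j X_def)+
    then have "q powi (- int j) * qint (\<alpha> + 1) = q powi (- 2 * int s) * qint X
       + q powi (int y - 1) * q powi (- \<alpha> - int j) * qint (int y)"
      unfolding a distrib_left mult.assoc[symmetric] by simp
    then show ?thesis unfolding e mult.assoc t3 unfolding t1 t2 b mult.assoc[symmetric] using nz
      by (simp add: divide_simps) (simp add: algebra_simps)
  qed
qed

text \<open>Both ends of the telescoping sum vanish, one through \<open>[0]\<close> and the other by
  the cut-off. So \<open>[j + 1]\<close> times the sum is a multiple of the sum for \<open>j\<close>
  and \<alpha> + 1, which is why the induction generalizes \<alpha>.\<close>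

lemma sum_nterm:
  "j \<ge> 1 \<Longrightarrow> (\<Sum>s\<le>j. nterm \<alpha> j s) = q powi (- int (j choose 2)) * qrise (\<alpha> + 1) (j - 1) / qfact j"
proof (induction j arbitrary: \<alpha> rule: dec_induct)
  case base
  show ?case by (simp add: nterm_def numeral_2_eq_2)
next
  case (step j)
  let ?G = "\<lambda>s. q powi (int (Suc j) - 2 * int s) * qint (2 * int s) * nterm \<alpha> (Suc j) s"
  have "(\<Sum>s<Suc (Suc j). qint (int (Suc j)) * nterm \<alpha> (Suc j) s - q powi (- int j) * qint (\<alpha> + 1) * nterm (\<alpha> + 1) j s)
     = (\<Sum>s<Suc (Suc j). ?G s - ?G (Suc s))"
    by (rule sum.cong) (use step.hyps nterm_telescope in auto)
  also have "\<dots> = ?G 0 - ?G (Suc (Suc j))"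
    by (rule sum_lessThan_telescope')
  also have "\<dots> = 0" by (simp add: nterm_def)
  finally have "qint (int (Suc j)) * (\<Sum>s\<le>Suc j. nterm \<alpha> (Suc j) s)
      = q powi (- int j) * qint (\<alpha> + 1) * (\<Sum>s\<le>Suc j. nterm (\<alpha> + 1) j s)"
    by (simp only: sum_subtractf sum_distrib_left lessThan_Suc_atMost)
  also have "(\<Sum>s\<le>Suc j. nterm (\<alpha> + 1) j s) = (\<Sum>s\<le>j. nterm (\<alpha> + 1) j s)"
    by (simp add: nterm_def)
  also have "q powi (- int j) * qint (\<alpha> + 1) * \<dots> = q powi (- int (Suc j choose 2)) * (qint (\<alpha> + 1) * qrise (\<alpha> + 2) (j - 1)) / qfact j"
  proof -
    have "q powi (- int (Suc j choose 2)) = q powi (- int j) * q powi (- int (j choose 2))"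
      by (simp add: Suc_choose_2 q_powi_mult)
    then show ?thesis unfolding step.IH by (simp add: add.assoc)
  qed
  also have "qint (\<alpha> + 1) * qrise (\<alpha> + 2) (j - 1) = qrise (\<alpha> + 1) j"
    using step.hyps qrise_Suc_left[of "\<alpha> + 1" "j - 1"] by (simp add: add.assoc)
  finally show ?case
    by (simp add: field_simps)
qed

section \<open>Transition coefficients\<close>

text \<open>\<open>qbinom M r\<close> is the binomial coefficient of \<open>M + r\<close> over \<open>r\<close>. The names \<open>XY_coef\<close> below refer to the
  coefficients of \<open>X\<close> expanded in \<open>Y\<close>, where \<open>F\<close>, \<open>B\<close> and \<open>icb\<close> stand for the \<open>F\<close>-monomials,
  the \<open>B\<close>-monomials and the i-canonical basis; the index counts how far \<open>b\<close> and \<open>c\<close> are lowered.\<close>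

definition qbinom :: "int \<Rightarrow> nat \<Rightarrow> Qq" where
  "qbinom M r = qrise (M + 1) r / qfact r"

definition BF_coef :: "nat \<Rightarrow> int \<Rightarrow> int \<Rightarrow> Qq" where
  "BF_coef r \<alpha> M = q powi (int r * (\<alpha> - M) - int (Suc r choose 2)) * qbinom M r"

definition icbB_coef :: "int \<Rightarrow> nat \<Rightarrow> Qq" where
  "icbB_coef \<alpha> k = (if k = 0 then 1
     else if even \<alpha> then (- 1) ^ k * qrise2 \<alpha> k / qfact k
     else (- 1) ^ k * qint (\<alpha> + int k - 1) * (qrise2 (\<alpha> + 1) (k - 1) / qfact k))"

definition Bicb_coef :: "int \<Rightarrow> nat \<Rightarrow> Qq" where
  "Bicb_coef \<alpha> k = (if odd k then qint \<alpha> * (qrise2 (\<alpha> - int k + 2) (k - 1) / qfact k)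
     else qrise2 (\<alpha> - int k + 1) k / qfact k)"

text \<open>Composition of two expansions. Lowering \<open>b\<close> and \<open>c\<close> by
  \<open>k\<close> raises both \<alpha> and \<open>M = m - c\<close> by \<open>k\<close>, hence the
  shifted arguments.\<close>

definition icbF_coef :: "nat \<Rightarrow> int \<Rightarrow> int \<Rightarrow> Qq" where
  "icbF_coef j \<alpha> M = (\<Sum>k\<le>j. icbB_coef \<alpha> k * BF_coef (j - k) (\<alpha> + int k) (M + int k))"

lemma BF_coef_0 [simp]: "BF_coef 0 \<alpha> M = 1"
  by (simp add: BF_coef_def qbinom_def numeral_2_eq_2)

lemma icbF_coef_0 [simp]: "icbF_coef 0 \<alpha> M = 1"
  by (simp add: icbF_coef_def icbB_coef_def)

lemma qbinom_pascal: "qbinom M (Suc r) = q powi (1 + int r) * qbinom (M - 1) (Suc r) + q powi (- M) * qbinom M r"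
proof -
  have "qint (M + 1 + int r) = q powi (1 + int r) * qint M + q powi (- M) * qint (1 + int r)"
    using qint_add[of M "1 + int r"] by (simp add: add.assoc)
  moreover have "qint (1 + int r) \<noteq> 0" by (auto intro!: qint_nonzero)
  moreover have "qrise (M - 1 + 1) (Suc r) = qint M * qrise (M + 1) r"
    by (simp add: qrise_Suc_left)
  ultimately show ?thesis
    unfolding qbinom_def by (simp add: qrise_Suc) (simp add: divide_simps algebra_simps)
qed

text \<open>The power of \<open>q\<close> in \<open>BF_coef\<close> absorbs the coefficient of the
  first Pascal term, so the value at \<open>M - 1\<close> enters with coefficient 1.\<close>

lemma BF_coef_pascal: "BF_coef (Suc r) \<alpha> M = BF_coef (Suc r) \<alpha> (M - 1) + q powi (\<alpha> - 2 * M - int (Suc r)) * BF_coef r \<alpha> M"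
proof -
  have e1: "int (Suc r) * (\<alpha> - M) - int (Suc (Suc r) choose 2) + (1 + int r)
      = int (Suc r) * (\<alpha> - (M - 1)) - int (Suc (Suc r) choose 2)"
    by (simp add: algebra_simps)
  have e2: "int (Suc r) * (\<alpha> - M) - int (Suc (Suc r) choose 2) + (- M)
      = (\<alpha> - 2 * M - int (Suc r)) + (int r * (\<alpha> - M) - int (Suc r choose 2))"
    unfolding Suc_choose_2[of "Suc r"] by (simp add: algebra_simps)
  show ?thesis
    unfolding BF_coef_def qbinom_pascal[of M r] distrib_left q_powi_mult_left e1 e2 by simp
qed

text \<open>The recurrence survives summation because its exponent is unchanged when \<alpha> and
  \<open>M\<close> grow by \<open>k\<close> while \<open>j\<close> drops by \<open>k\<close>; the
  last term, \<open>k = j + 1\<close>, does not depend on \<open>M\<close>.\<close>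

lemma icbF_coef_pascal: "icbF_coef (Suc j) \<alpha> M = icbF_coef (Suc j) \<alpha> (M - 1) + q powi (\<alpha> - 2 * M - int (Suc j)) * icbF_coef j \<alpha> M"
proof -
  have "icbB_coef \<alpha> k * BF_coef (Suc j - k) (\<alpha> + int k) (M + int k)
     = icbB_coef \<alpha> k * BF_coef (Suc j - k) (\<alpha> + int k) (M - 1 + int k)
       + q powi (\<alpha> - 2 * M - int (Suc j)) * (icbB_coef \<alpha> k * BF_coef (j - k) (\<alpha> + int k) (M + int k))"
    if "k \<le> j" for k
  proof -
    have k: "Suc j - k = Suc (j - k)" using that by simp
    have e: "\<alpha> + int k - 2 * (M + int k) - int (Suc (j - k)) = \<alpha> - 2 * M - int (Suc j)"
      "M + int k - 1 = M - 1 + int k"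
      using that by (simp_all add: of_nat_diff)
    show ?thesis unfolding k BF_coef_pascal[of "j - k" "\<alpha> + int k" "M + int k"] e by (simp add: algebra_simps)
  qed
  then show ?thesis
    by (simp add: icbF_coef_def sum.distrib sum_distrib_left)
qed

section \<open>Values at M = \<alpha> - 1, the base of the recurrence\<close>

lemma BF_coef_base: "BF_coef r \<alpha> (\<alpha> - 1) = q powi (- int (r choose 2)) * qrise \<alpha> r / qfact r"
proof -
  have "int r * (\<alpha> - (\<alpha> - 1)) - int (Suc r choose 2) = - int (r choose 2)"
    by (simp add: Suc_choose_2)
  then show ?thesis by (simp add: BF_coef_def qbinom_def)
qed

lemma icbF_coef_base_even_hsum:
  assumes "even \<alpha>" "j \<ge> 1"
  shows "icbF_coef j \<alpha> (\<alpha> - 1) = qint \<alpha> * hsum j \<alpha>"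
proof -
  have "icbB_coef \<alpha> k * BF_coef (j - k) (\<alpha> + int k) (\<alpha> - 1 + int k) = wterm \<alpha> j k" for k
    using assms BF_coef_base[of "j - k" "\<alpha> + int k"] by (simp add: icbB_coef_def wterm_def algebra_simps)
  then show ?thesis using assms by (simp add: icbF_coef_def sum_wterm)
qed

text \<open>The factor \<open>[\<alpha> + k - 1]\<close> of \<open>icbB_coef\<close> extends the
  rising product at its lower end; splitting the extended product at its upper end leaves
  \<open>[\<alpha> + j - 1]\<close>, which is independent of \<open>k\<close>.\<close>

lemma icbF_coef_base_odd_hsum:
  assumes "odd \<alpha>" "j \<ge> 1"
  shows "icbF_coef j \<alpha> (\<alpha> - 1) = qint (\<alpha> + int j - 1) * hsum j (\<alpha> - 1)"
proof -
  have "icbB_coef \<alpha> k * BF_coef (j - k) (\<alpha> + int k) (\<alpha> - 1 + int k) = qint (\<alpha> + int j - 1) * hterm (\<alpha> - 1) j k"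
    if "k \<le> j" for k
  proof -
    have Q: "BF_coef (j - k) (\<alpha> + int k) (\<alpha> - 1 + int k)
       = q powi (- int ((j - k) choose 2)) * qrise (\<alpha> + int k) (j - k) / qfact (j - k)"
      using BF_coef_base[of "j - k" "\<alpha> + int k"] by (simp add: algebra_simps)
    show ?thesis
    proof (cases "k = 0")
      \<comment> \<open>For \<open>k = 0\<close> the prefactor is 1 by convention, and
        \<open>[\<alpha> + j - 1]\<close> is the last factor of
        \<open>qrise \<alpha> j\<close>.\<close>
      case True
      have "qrise \<alpha> j = qint (\<alpha> + int j - 1) * qrise \<alpha> (j - 1)"
        using assms qrise_Suc[of \<alpha> "j - 1"] by (simp add: algebra_simps of_nat_diff)
      then show ?thesis unfolding Q using True by (simp add: icbB_coef_def hterm_def)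
    next
      case False
      have "qint (\<alpha> + int k - 1) * qrise (\<alpha> + int k) (j - k) = qrise (\<alpha> + int k - 1) (Suc (j - k))"
        by (simp add: qrise_Suc_left)
      also have "\<dots> = qint (\<alpha> + int j - 1) * qrise (\<alpha> - 1 + int k) (j - k)"
        using that by (simp add: qrise_Suc of_nat_diff algebra_simps)
      finally have e: "qint (\<alpha> + int k - 1) * qrise (\<alpha> + int k) (j - k)
        = qint (\<alpha> + int j - 1) * qrise (\<alpha> - 1 + int k) (j - k)" .
      have "icbB_coef \<alpha> k * BF_coef (j - k) (\<alpha> + int k) (\<alpha> - 1 + int k)
        = (- 1) ^ k * qrise2 (\<alpha> + 1) (k - 1) / qfact k * q powi (- int ((j - k) choose 2)) / qfact (j - k)
          * (qint (\<alpha> + int k - 1) * qrise (\<alpha> + int k) (j - k))"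
        unfolding Q using False assms by (simp add: icbB_coef_def)
      then show ?thesis unfolding e using False by (simp add: hterm_def add.commute)
    qed
  qed
  then show ?thesis by (simp add: icbF_coef_def hsum_def sum_distrib_left)
qed

lemma icbF_coef_base_odd: "odd j \<Longrightarrow> icbF_coef j \<alpha> (\<alpha> - 1) = 0"
  using icbF_coef_base_even_hsum[of \<alpha> j] icbF_coef_base_odd_hsum[of \<alpha> j] odd_pos[of j] by (cases "even \<alpha>") (auto simp: hsum_odd)

lemma icbF_coef_base_even_even:
  assumes "even \<alpha>"
  shows "icbF_coef (2 * s) \<alpha> (\<alpha> - 1) = q powi (int s * (1 - \<alpha> - 2 * int s)) * qrise2 \<alpha> s / qdfact s"
proof (cases s)
  case (Suc t)
  show ?thesis unfolding Suc
    by (subst icbF_coef_base_even_hsum) (use assms in \<open>simp_all only: hsum_even qrise2_Suc_left, simp_all\<close>)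
qed simp

lemma icbF_coef_base_odd_even:
  assumes "odd \<alpha>"
  shows "icbF_coef (2 * s) \<alpha> (\<alpha> - 1) = q powi (int s * (2 - \<alpha> - 2 * int s)) * qrise2 (\<alpha> + 1) s / qdfact s"
proof (cases s)
  case (Suc t)
  have e: "1 - (\<alpha> - 1) = 2 - \<alpha>" "\<alpha> - 1 + 2 = \<alpha> + 1" "\<alpha> + int (2 * Suc t) - 1 = \<alpha> + 1 + 2 * int t" by simp_all
  have 1: "1 \<le> 2 * Suc t" by simp
  show ?thesis
    unfolding Suc icbF_coef_base_odd_hsum[OF assms 1] hsum_even e qrise2_Suc by simp
qed simp

lemma sum_even_indices:
  fixes f :: "nat \<Rightarrow> 'a::comm_monoid_add"
  assumes "\<And>r. odd r \<Longrightarrow> r \<le> j \<Longrightarrow> f r = 0"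
  shows "(\<Sum>r\<le>j. f r) = (\<Sum>s\<le>j. if 2 * s \<le> j then f (2 * s) else 0)"
proof -
  have "(\<Sum>r\<le>j. f r) = (\<Sum>r\<in>{r. r \<le> j \<and> even r}. f r)"
    by (rule sum.mono_neutral_right) (use assms in auto)
  also have "{r. r \<le> j \<and> even r} = (\<lambda>s. 2 * s) ` {s. 2 * s \<le> j}"
    by (auto elim!: evenE)
  also have "sum f \<dots> = (\<Sum>s | 2 * s \<le> j. f (2 * s))"
    by (subst sum.reindex) (auto simp: inj_on_def)
  also have "\<dots> = (\<Sum>s\<in>{s \<in> {..j}. 2 * s \<le> j}. f (2 * s))"
    by (rule sum.cong) auto
  also have "\<dots> = (\<Sum>s\<le>j. if 2 * s \<le> j then f (2 * s) else 0)"
    by (rule sum.inter_filter) simp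
  finally show ?thesis .
qed

text \<open>Only even \<open>r\<close> contribute, by \<open>icbF_coef_base_odd\<close>. For these
  the step-two products of \<open>Bicb_coef\<close> and \<open>icbF_coef\<close> are adjacent and
  merge into the one product in \<open>nterm\<close>, so \<open>sum_nterm\<close> applies.\<close>

lemma BF_coef_expansion_base:
  assumes "odd \<alpha>"
  shows "BF_coef j \<alpha> (\<alpha> - 1) = (\<Sum>k\<le>j. Bicb_coef \<alpha> k * icbF_coef (j - k) (\<alpha> + int k) (\<alpha> + int k - 1))"
proof (cases "j = 0")
  case True
  then show ?thesis by (simp add: Bicb_coef_def)
next
  case False
  define f where "f r = Bicb_coef \<alpha> (j - r) * icbF_coef r (\<alpha> + int (j - r)) (\<alpha> + int (j - r) - 1)" for r
  \<comment> \<open>As \<open>r\<close> is even, \<open>k = j - r\<close> has the parity of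
    \<open>j\<close>, so only one of the two shapes of \<open>Bicb_coef\<close> occurs. The factor
    \<open>g\<close> is the last factor of the merged product for even \<open>j\<close> and the
    prefactor \<open>[\<alpha>]\<close> for odd \<open>j\<close>.\<close>
  define \<beta> where "\<beta> = (if even j then \<alpha> - 1 else \<alpha>)"
  define g where "g = (if even j then qint (\<alpha> + int j - 1) else qint \<alpha>)"
  have f: "f (2 * s) = g * nterm \<beta> j s" if "2 * s \<le> j" for s
  proof (cases "even j")
    case True
    let ?k = "j - 2 * s"
    have k: "int ?k = int j - 2 * int s" using that by (simp add: of_nat_diff)
    have "even ?k" and o: "odd (\<alpha> + int ?k)" using True assms by auto
    have e: "2 - (\<alpha> + int ?k) - 2 * int s = 1 - (\<alpha> - 1) - int j"
      "\<alpha> - int ?k + 1 + 2 * int ?k = \<alpha> + int ?k + 1" "?k + s = Suc (j - s - 1)"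
      "\<alpha> - int ?k + 1 + 2 * int (j - s - 1) = \<alpha> + int j - 1"
      "\<alpha> - 1 - int j + 2 * int s + 2 = \<alpha> - int ?k + 1"
      using k that False by (simp_all add: of_nat_diff)
    have "qrise2 (\<alpha> - int ?k + 1) ?k * qrise2 (\<alpha> + int ?k + 1) s = qrise2 (\<alpha> - int ?k + 1) (j - s - 1) * qint (\<alpha> + int j - 1)"
      using qrise2_add[of "\<alpha> - int ?k + 1" ?k s] unfolding e qrise2_Suc by simp
    then show ?thesis
      using that True \<open>even ?k\<close> unfolding f_def icbF_coef_base_odd_even[OF o] e nterm_def \<beta>_def g_def
      by (simp add: Bicb_coef_def e(5)) 
  next
    case odd: False
    let ?k = "j - 2 * s"
    have k: "int ?k = int j - 2 * int s" using that by (simp add: of_nat_diff)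
    have "odd ?k" and o: "even (\<alpha> + int ?k)" using odd that assms by auto
    then have k1: "?k \<ge> 1" using odd_pos by fastforce
    have e: "1 - (\<alpha> + int ?k) - 2 * int s = 1 - \<alpha> - int j"
      "\<alpha> - int ?k + 2 + 2 * int (?k - 1) = \<alpha> + int ?k" "?k - 1 + s = j - s - 1"
      "\<alpha> - int j + 2 * int s + 2 = \<alpha> - int ?k + 2"
      using k that False k1 by (simp_all add: of_nat_diff)
    have "qrise2 (\<alpha> - int ?k + 2) (?k - 1) * qrise2 (\<alpha> + int ?k) s = qrise2 (\<alpha> - int ?k + 2) (j - s - 1)"
      using qrise2_add[of "\<alpha> - int ?k + 2" "?k - 1" s] unfolding e by simp
    then show ?thesis
      using that odd \<open>odd ?k\<close> unfolding f_def icbF_coef_base_even_even[OF o] e nterm_def \<beta>_def g_def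
      by (simp add: Bicb_coef_def e(4))
  qed
  have "(\<Sum>k\<le>j. Bicb_coef \<alpha> k * icbF_coef (j - k) (\<alpha> + int k) (\<alpha> + int k - 1)) = (\<Sum>r\<le>j. f r)"
    by (rule sum.reindex_bij_witness[of _ "\<lambda>r. j - r" "\<lambda>r. j - r"]) (auto simp: f_def)
  also have "\<dots> = (\<Sum>s\<le>j. if 2 * s \<le> j then f (2 * s) else 0)"
    by (rule sum_even_indices) (simp add: f_def icbF_coef_base_odd)
  also have "\<dots> = (\<Sum>s\<le>j. g * nterm \<beta> j s)"
    by (rule sum.cong) (auto simp: f nterm_def)
  also have "\<dots> = g * (q powi (- int (j choose 2)) * qrise (\<beta> + 1) (j - 1) / qfact j)"
    using False by (simp add: sum_nterm flip: sum_distrib_left)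
  \<comment> \<open>\<open>g\<close> restores the factor of \<open>qrise \<alpha> j\<close> missing
    at its upper or its lower end.\<close>
  also have "g * qrise (\<beta> + 1) (j - 1) = qrise \<alpha> j"
  proof -
    obtain i where j: "j = Suc i" using False by (cases j) auto
    show ?thesis
    proof (cases "even j")
      case True
      then show ?thesis using qrise_Suc[of \<alpha> i] by (simp add: g_def \<beta>_def j)
    next
      case False
      then show ?thesis using qrise_Suc_left[of \<alpha> i] by (simp add: g_def \<beta>_def j)
    qed
  qed
  then have "g * (q powi (- int (j choose 2)) * qrise (\<beta> + 1) (j - 1) / qfact j) = BF_coef j \<alpha> (\<alpha> - 1)"
    unfolding BF_coef_base by (simp add: ac_simps flip: times_divide_eq_right)
  finally show ?thesis by simp
qed

text \<open>\<open>Bicb_coef\<close> does not involve \<open>M\<close>, so the right-hand side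
  inherits the recurrence of \<open>icbF_coef\<close>, which is that of \<open>BF_coef\<close>. The
  outer induction is on \<open>M\<close>, the inner one on \<open>j\<close>.\<close>

lemma BF_coef_expansion:
  assumes "odd \<alpha>" "M \<ge> \<alpha> - 1"
  shows "BF_coef j \<alpha> M = (\<Sum>k\<le>j. Bicb_coef \<alpha> k * icbF_coef (j - k) (\<alpha> + int k) (M + int k))"
  using assms(2)
proof (induction M arbitrary: j rule: int_ge_induct)
  case base
  show ?case using BF_coef_expansion_base[OF assms(1)] by (simp add: algebra_simps)
next
  case (step M)
  show ?case
  proof (induction j)
    case 0
    show ?case by (simp add: Bicb_coef_def)
  next
    case (Suc j)
    let ?z = "q powi (\<alpha> - 2 * (M + 1) - int (Suc j))"
    have "Bicb_coef \<alpha> k * icbF_coef (Suc j - k) (\<alpha> + int k) (M + 1 + int k)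
      = Bicb_coef \<alpha> k * icbF_coef (Suc j - k) (\<alpha> + int k) (M + int k)
        + ?z * (Bicb_coef \<alpha> k * icbF_coef (j - k) (\<alpha> + int k) (M + 1 + int k))" if "k \<le> j" for k
    proof -
      have k: "Suc j - k = Suc (j - k)" using that by simp
      have e: "\<alpha> + int k - 2 * (M + 1 + int k) - int (Suc (j - k)) = \<alpha> - 2 * (M + 1) - int (Suc j)"
        "M + 1 + int k - 1 = M + int k"
        using that by (simp_all add: of_nat_diff)
      show ?thesis unfolding k icbF_coef_pascal[of "j - k" "\<alpha> + int k" "M + 1 + int k"] e by (simp add: algebra_simps)
    qed
    then have "(\<Sum>k\<le>Suc j. Bicb_coef \<alpha> k * icbF_coef (Suc j - k) (\<alpha> + int k) (M + 1 + int k))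
      = (\<Sum>k\<le>Suc j. Bicb_coef \<alpha> k * icbF_coef (Suc j - k) (\<alpha> + int k) (M + int k))
        + ?z * (\<Sum>k\<le>j. Bicb_coef \<alpha> k * icbF_coef (j - k) (\<alpha> + int k) (M + 1 + int k))"
      by (simp add: sum.distrib sum_distrib_left)
    then show ?case
      using step.IH[of "Suc j"] Suc.IH BF_coef_pascal[of j \<alpha> "M + 1"] by simp
  qed
qed

section \<open>Integrality and bar invariance\<close>

lemma q_powi_power: "(q powi k) ^ n = q powi (k * int n)"
  by (simp only: power_int_mult power_int_of_nat)

text \<open>The ring Z[q^-1]; \<open>qinv_Z\<close> is \<open>q^-1\<close> times it.\<close>

definition Zqinv :: "Qq set" where
  "Zqinv = range (\<lambda>p :: int poly. poly (map_poly of_int p) (inverse q))"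

lemma poly_map_of_int_pCons: "poly (map_poly of_int (pCons a p)) x = of_int a + x * poly (map_poly of_int p) x"
  for x :: Qq
  by (simp add: map_poly_pCons)

lemma poly_map_of_int_add:
  "poly (map_poly of_int (p + p')) x = poly (map_poly of_int p) x + poly (map_poly of_int p') x" for x :: Qq
proof -
  have "map_poly of_int (p + p') = map_poly of_int p + (map_poly of_int p' :: Qq poly)"
    by (intro poly_eqI) (simp add: coeff_map_poly)
  then show ?thesis by simp
qed

lemma poly_map_of_int_smult:
  "poly (map_poly of_int (smult a p)) x = of_int a * poly (map_poly of_int p) x" for x :: Qq
proof -
  have "map_poly of_int (smult a p) = smult (of_int a) (map_poly of_int p :: Qq poly)"
    by (intro poly_eqI) (simp add: coeff_map_poly)
  then show ?thesis by simp
qed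

lemma poly_map_of_int_mult:
  "poly (map_poly of_int (p * p')) x = poly (map_poly of_int p) x * poly (map_poly of_int p') x" for x :: Qq
proof (induction p)
  case (pCons a p)
  have "pCons a p * p' = smult a p' + pCons 0 (p * p')" by simp
  then show ?case
    using pCons.IH by (simp only: poly_map_of_int_add poly_map_of_int_smult poly_map_of_int_pCons) (simp add: algebra_simps)
qed simp

lemma Zqinv_of_int: "of_int a \<in> Zqinv"
  unfolding Zqinv_def by (rule range_eqI[of _ _ "[:a:]"]) (simp add: map_poly_pCons)

lemma Zqinv_0 [simp]: "0 \<in> Zqinv" and Zqinv_1 [simp]: "1 \<in> Zqinv"
  using Zqinv_of_int[of 0] Zqinv_of_int[of 1] by simp_all

lemma Zqinv_add: "x \<in> Zqinv \<Longrightarrow> y \<in> Zqinv \<Longrightarrow> x + y \<in> Zqinv"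
  unfolding Zqinv_def using poly_map_of_int_add by (auto intro: range_eqI[OF sym])

lemma Zqinv_mult: "x \<in> Zqinv \<Longrightarrow> y \<in> Zqinv \<Longrightarrow> x * y \<in> Zqinv"
  unfolding Zqinv_def using poly_map_of_int_mult by (auto intro: range_eqI[OF sym])

lemma Zqinv_uminus: "x \<in> Zqinv \<Longrightarrow> - x \<in> Zqinv"
  using Zqinv_mult[OF Zqinv_of_int[of "- 1"]] by simp

lemma Zqinv_inverse_q: "inverse q \<in> Zqinv"
  unfolding Zqinv_def by (rule range_eqI[of _ _ "[:0, 1:]"]) (simp add: map_poly_pCons)

lemma Zqinv_powi: "k \<le> 0 \<Longrightarrow> q powi k \<in> Zqinv"
proof -
  assume k: "k \<le> 0"
  have "inverse q ^ n \<in> Zqinv" for n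
    by (induction n) (simp_all add: Zqinv_mult Zqinv_inverse_q)
  then show ?thesis using k by (simp add: power_int_def)
qed

lemma qinv_Z_iff: "x \<in> qinv_Z \<longleftrightarrow> (\<exists>y \<in> Zqinv. x = inverse q * y)"
  by (auto simp: qinv_Z_def Zqinv_def)

lemma qinv_Z_subset: "x \<in> qinv_Z \<Longrightarrow> x \<in> Zqinv"
  by (auto simp: qinv_Z_iff Zqinv_mult Zqinv_inverse_q)

lemma qinv_Z_0 [simp]: "0 \<in> qinv_Z"
  unfolding qinv_Z_iff by (rule bexI[of _ 0]) simp_all

lemma qinv_Z_add: "x \<in> qinv_Z \<Longrightarrow> y \<in> qinv_Z \<Longrightarrow> x + y \<in> qinv_Z"
  unfolding qinv_Z_iff by (auto simp: Zqinv_add simp flip: distrib_left)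

lemma qinv_Z_uminus: "x \<in> qinv_Z \<Longrightarrow> - x \<in> qinv_Z"
  unfolding qinv_Z_iff by (auto simp: Zqinv_uminus simp flip: mult_minus_right)

lemma qinv_Z_mult: "x \<in> qinv_Z \<Longrightarrow> y \<in> Zqinv \<Longrightarrow> x * y \<in> qinv_Z"
  unfolding qinv_Z_iff by (auto simp: Zqinv_mult mult.assoc)

lemma qinv_Z_powi: "k < 0 \<Longrightarrow> q powi k \<in> qinv_Z"
proof -
  assume "k < 0"
  then have "q powi (k + 1) \<in> Zqinv" by (intro Zqinv_powi) simp
  moreover have "q powi k = inverse q * q powi (k + 1)" by (simp add: power_int_add)
  ultimately show ?thesis unfolding qinv_Z_iff by blast
qed

lemma qinv_Z_powi_mult: "k < 0 \<Longrightarrow> y \<in> Zqinv \<Longrightarrow> q powi k * y \<in> qinv_Z"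
  by (simp add: qinv_Z_mult qinv_Z_powi)

text \<open>Turns integral polynomials in \<open>q^-1\<close> into values of
  \<open>eval_inv\<close>, the substitution through which \<open>qbar\<close> is defined.\<close>

lemma map_poly_const_fract: "map_poly (\<lambda>r. to_fract [:r:]) (map_poly rat_of_int p) = map_poly of_int p"
proof -
  have "to_fract [:of_int a:] = (of_int a :: Qq)" for a
  proof -
    have "to_fract [:r + s:] = to_fract [:r:] + to_fract [:s:]"
      "to_fract [:r - s:] = to_fract [:r:] - to_fract [:s:]" for r s :: rat
      by (simp_all flip: to_fract_add to_fract_diff)
    moreover have "to_fract [:1::rat:] = 1" by (simp flip: one_pCons)
    ultimately show ?thesis by (induction a rule: int_induct[of _ 0]) simp_all
  qed
  then show ?thesis by (intro poly_eqI) (simp add: coeff_map_poly)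
qed

text \<open>If \<open>x = q^-1 p(q^-1)\<close> is invariant, it equals \<open>q p(q)\<close>.
  Multiplying by \<open>q^(d+1)\<close> with \<open>d = degree p\<close> equates the reflected
  polynomial, of degree at most \<open>d\<close>, with \<open>X^(d+2) p\<close>, of degree
  \<open>2d + 2\<close>.\<close>

lemma qinv_Z_bar_invariant:
  assumes "x \<in> qinv_Z" "qbar x = x"
  shows "x = 0"
proof (rule ccontr)
  assume "x \<noteq> 0"
  obtain p :: "int poly" where "x = inverse q * poly (map_poly of_int p) (inverse q)"
    using assms(1) by (auto simp: qinv_Z_def)
  then have x: "x = inverse q * eval_inv (map_poly of_int p)" (is "_ = _ * eval_inv ?p")
    by (simp add: eval_inv_def map_poly_const_fract)
  have p: "?p \<noteq> 0" using \<open>x \<noteq> 0\<close> x by auto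
  have bar_to_fract: "qbar (to_fract r) = eval_inv r" for r
    using qbar_fract[of 1 r] by (simp add: to_fract_def)
  have inv_q: "inverse q = eval_inv [:0, 1:]"
    using bar_to_fract[of "[:0, 1:]"] qbar_q by (simp add: q_def)
  have bar_inv: "qbar (eval_inv r) = to_fract r" for r
  proof -
    have "qbar (to_fract [:c:]) = to_fract [:c:]" for c
      by (simp add: bar_to_fract eval_inv_pCons)
    moreover have "qbar (inverse q) = q"
      using qbar_mult[of q "inverse q"] by (simp add: qbar_1 qbar_q field_simps)
    moreover have "qbar 0 = 0" using bar_to_fract[of 0] by simp
    moreover have "to_fract [:c:] + q * to_fract r = to_fract (pCons c r)" for c r
      by (simp add: q_def flip: to_fract_add to_fract_mult)
    ultimately show ?thesis
      by (induction r) (simp_all add: eval_inv_pCons qbar_add qbar_mult)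
  qed
  have "inverse q * eval_inv ?p = to_fract ([:0, 1:] * ?p)"
    using assms(2) bar_inv[of "[:0, 1:] * ?p"] unfolding x inv_q eval_inv_mult[symmetric] by (rule trans[OF sym])
  also have "\<dots> = q * to_fract ?p"
    by (simp only: q_def to_fract_mult)
  finally have "q ^ (degree ?p + 1) * (inverse q * eval_inv ?p) = q ^ (degree ?p + 1) * (q * to_fract ?p)"
    by (rule arg_cong)
  moreover have "q ^ (n + 1) * (inverse q * y) = q ^ n * y" "q ^ (n + 1) * (q * y) = q ^ (n + 2) * y" for n y
    by simp_all
  ultimately have "q ^ degree ?p * eval_inv ?p = q ^ (degree ?p + 2) * to_fract ?p"
    by (simp only:)
  then have "to_fract (reflect_poly ?p) = to_fract ([:0, 1:] ^ (degree ?p + 2) * ?p)"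
  proof -
    have "to_fract ([:0, 1:] ^ n) = q ^ n" for n :: nat
      by (induction n) (simp_all only: power_0 power_Suc to_fract_mult to_fract_1 q_def)
    then show ?thesis
      unfolding to_fract_mult eval_inv_reflect[OF p] \<open>q ^ degree ?p * eval_inv ?p = _\<close> by (simp only:)
  qed
  then have "degree (reflect_poly ?p) = degree ([:0, 1:] ^ (degree ?p + 2) * ?p)"
    by (simp only: to_fract_eq_iff)
  also have "\<dots> = (degree ?p + 2) + degree ?p"
  proof -
    have "degree ([:0, 1 :: rat:] ^ n * r) = n + degree r" if "r \<noteq> 0" for n r
      using that by (subst degree_mult_eq) (simp_all add: degree_power_eq)
    then show ?thesis using p by blast
  qed
  finally show False
    using degree_reflect_poly_le[of ?p] by simp
qed

section \<open>Bar invariance of quantum integers and of \<open>icbB_coef\<close>\<close>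

lemma qbar_0 [simp]: "qbar 0 = 0"
  using qbar_add[of 0 0] by simp

lemma qbar_uminus: "qbar (- x) = - qbar x"
  using qbar_add[of x "- x"] by (simp add: eq_neg_iff_add_eq_0 add.commute)

lemma qbar_diff: "qbar (x - y) = qbar x - qbar y"
  using qbar_add[of x "- y"] by (simp add: qbar_uminus)

lemma qbar_inverse: "qbar (inverse x) = inverse (qbar x)"
proof (cases "x = 0")
  case False
  then have "qbar x * qbar (inverse x) = 1" by (simp add: qbar_1 flip: qbar_mult)
  then show ?thesis by (simp add: inverse_unique)
qed simp

lemma qbar_divide: "qbar (x / y) = qbar x / qbar y"
  by (simp add: divide_inverse qbar_mult qbar_inverse)

lemma qbar_power: "qbar (x ^ n) = qbar x ^ n"
  by (induction n) (simp_all add: qbar_1 qbar_mult)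

lemma qbar_powi: "qbar (q powi k) = q powi (- k)"
  by (simp add: power_int_def qbar_power qbar_q qbar_inverse qbar_1)

lemma qbar_qint [simp]: "qbar (qint r) = qint r"
proof -
  have "qbar (qint r) = (q powi (- r) - q powi r) / (inverse q - q)"
    by (simp add: qint_def qbar_divide qbar_diff qbar_powi qbar_q qbar_inverse)
  also have "\<dots> = qint r"
    using q_minus_inverse_nonzero by (simp add: qint_def divide_simps) (simp add: algebra_simps)
  finally show ?thesis .
qed

lemma qbar_prod: "qbar (prod f A) = (\<Prod>x\<in>A. qbar (f x))"
  by (induction A rule: infinite_finite_induct) (simp_all add: qbar_1 qbar_mult)

lemma qbar_qfact [simp]: "qbar (qfact n) = qfact n"
  by (simp add: qfact_def qbar_prod)

lemma qbar_qrise2 [simp]: "qbar (qrise2 x n) = qrise2 x n"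
  by (simp add: qrise2_def qbar_prod)

lemma qbar_icbB_coef [simp]: "qbar (icbB_coef \<alpha> k) = icbB_coef \<alpha> k"
  by (simp add: icbB_coef_def qbar_1 qbar_mult qbar_divide qbar_power qbar_uminus)

text \<open>For \<open>p = q\<^sup>-\<^sup>2\<^sup>k\<close> this is a balanced binomial coefficient in \<open>q\<^sup>k\<close> divided by its top power of \<open>q\<close>.\<close>

definition gauss :: "Qq \<Rightarrow> nat \<Rightarrow> nat \<Rightarrow> Qq" where
  "gauss p M j = (\<Prod>i<j. (1 - p ^ (M + 1 + i)) / (1 - p ^ (1 + i)))"

lemma gauss_pascal:
  assumes "\<And>n. n > 0 \<Longrightarrow> p ^ n \<noteq> 1"
  shows "gauss p (Suc M) (Suc j) = gauss p M (Suc j) + p ^ Suc M * gauss p (Suc M) j"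
proof -
  define d where "d j = (\<Prod>i<j. 1 - p ^ (1 + i))" for j
  define g where "g M j = (\<Prod>i<j. 1 - p ^ (M + 1 + i))" for M j
  have gauss: "gauss p M j = g M j / d j" for M j
    by (simp add: gauss_def g_def d_def prod_dividef)
  have d: "d (Suc j) = d j * (1 - p ^ Suc j)" by (simp add: d_def)
  have nz: "1 - p ^ Suc j \<noteq> 0" "d j \<noteq> 0" using assms by (auto simp: d_def simp del: power_Suc)
  have g1: "g M (Suc j) = (1 - p ^ Suc M) * g (Suc M) j"
    by (simp add: g_def prod.lessThan_Suc_shift algebra_simps del: prod.lessThan_Suc)
  have g2: "g (Suc M) (Suc j) = g (Suc M) j * (1 - p ^ (Suc M + Suc j))"
    by (simp add: g_def)
  show ?thesis
    unfolding gauss d g1 g2 power_add using nz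
    by (simp add: divide_simps del: power_Suc) (simp add: algebra_simps)
qed

lemma gauss_0 [simp]: "gauss p M 0 = 1"
  by (simp add: gauss_def)

text \<open>The quotient does not show integrality, but the Pascal recurrence has powers of
  \<open>p\<close> as its only coefficients.\<close>

lemma gauss_Zqinv:
  assumes "p \<in> Zqinv" "\<And>n. n > 0 \<Longrightarrow> p ^ n \<noteq> 1"
  shows "gauss p M j \<in> Zqinv"
proof (induction M arbitrary: j)
  case 0
  have "gauss p 0 j = 1"
    using assms(2) unfolding gauss_def by (intro prod.neutral) (auto simp del: power_Suc)
  then show ?case by simp
next
  case (Suc M)
  have p: "p ^ n \<in> Zqinv" for n by (induction n) (simp_all add: Zqinv_mult assms)
  show ?case
  proof (induction j)
    case (Suc j)
    have "gauss p (Suc M) (Suc j) = gauss p M (Suc j) + p ^ Suc M * gauss p (Suc M) j"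
      by (rule gauss_pascal) (fact assms(2))
    then show ?case
      using p Suc.IH \<open>\<And>j. gauss p M j \<in> Zqinv\<close> by (simp only: Zqinv_add Zqinv_mult)
  qed simp
qed

text \<open>Pulling \<open>q^x\<close> out of \<open>[x]\<close> leaves a multiple of
  \<open>1 - q^(-2x)\<close>. Used with \<open>k = 1\<close> for binomials and with
  \<open>k = 2\<close> for step-two products over \<open>qdfact\<close>.\<close>

lemma prod_qint_ratio:
  assumes "k > 0"
  shows "(\<Prod>i<r. qint (k * (int M + 1 + int i)) / qint (k * (1 + int i)))
    = q powi (k * int M * int r) * gauss (q powi (- 2 * k)) M r"
proof -
  have qint_form: "qint x = q powi x / (q - inverse q) * (1 - q powi (- 2 * x))" for x
    by (simp add: qint_def right_diff_distrib diff_divide_distrib q_powi_mult)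
  have pow: "q powi (- 2 * k * int n) = (q powi (- 2 * k)) ^ n" for n
    by (simp only: q_powi_power)
  have "qint (k * (int M + 1 + int i)) / qint (k * (1 + int i))
     = q powi (k * int M) * ((1 - (q powi (- 2 * k)) ^ (M + 1 + i)) / (1 - (q powi (- 2 * k)) ^ (1 + i)))" for i
  proof -
    have "q powi (k * (int M + 1 + int i)) = q powi (k * int M) * q powi (k * (1 + int i))"
      by (simp add: q_powi_mult algebra_simps)
    moreover have e: "- 2 * (k * (int M + 1 + int i)) = - 2 * k * int (M + 1 + i)"
      "- 2 * (k * (1 + int i)) = - 2 * k * int (1 + i)" by (simp_all add: algebra_simps)
    ultimately show ?thesis
      unfolding qint_form pow[symmetric] e using q_minus_inverse_nonzero by simp
  qed
  then have "(\<Prod>i<r. qint (k * (int M + 1 + int i)) / qint (k * (1 + int i)))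
     = (q powi (k * int M)) ^ r * gauss (q powi (- 2 * k)) M r"
    by (simp only: gauss_def prod.distrib prod_constant card_lessThan)
  then show ?thesis by (simp only: q_powi_power)
qed

lemma gauss_q_Zqinv:
  assumes "k > 0"
  shows "gauss (q powi (- 2 * k)) M r \<in> Zqinv"
proof (rule gauss_Zqinv)
  show "q powi (- 2 * k) \<in> Zqinv" using assms by (simp add: Zqinv_powi)
  show "(q powi (- 2 * k)) ^ n \<noteq> 1" if "n > 0" for n
    using q_powi_eq_1_iff[of "- 2 * k * int n"] assms that unfolding q_powi_power by simp
qed

lemma qbinom_gauss: "qbinom (int M) r = q powi (int M * int r) * gauss (q powi (- 2)) M r"
proof -
  have "qfact r = (\<Prod>i<r. qint (1 + int i))"
    by (induction r) simp_all
  then show ?thesis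
    using prod_qint_ratio[of 1 M r] by (simp add: qbinom_def qrise_def prod_dividef)
qed

lemma qbinom_Zqinv: "M \<ge> 0 \<Longrightarrow> q powi (- (int r * M)) * qbinom M r \<in> Zqinv"
  using qbinom_gauss[of "nat M" r] gauss_q_Zqinv[of 1 "nat M" r]
  by (simp add: q_powi_mult_left algebra_simps)

lemma qrise2_qdfact_gauss: "qrise2 (2 * (int g + 1)) s / qdfact s = q powi (2 * int g * int s) * gauss (q powi (- 4)) g s"
proof -
  have "qdfact s = (\<Prod>i<s. qint (2 * (1 + int i)))"
    by (induction s) simp_all
  then show ?thesis
    using prod_qint_ratio[of 2 g s] by (simp add: qrise2_def prod_dividef algebra_simps)
qed

text \<open>At \<open>j = 2s\<close> the value is a power of \<open>q\<close> times a step-two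
  product over \<open>qdfact s\<close>. Reading that quotient as a Gaussian binomial in
  \<open>q^-4\<close> costs \<open>q^(2gs)\<close>; the exponents left over are those in
  \<open>neg\<close>.\<close>

lemma icbF_coef_base_qinv:
  assumes "\<alpha> \<ge> 1" "j \<ge> 1"
  shows "icbF_coef j \<alpha> (\<alpha> - 1) \<in> qinv_Z"
proof (cases "even j")
  case True
  then obtain s where j: "j = 2 * s" by auto
  then have s: "s \<ge> 1" using assms by auto
  have G: "gauss (q powi (- 4)) g s \<in> Zqinv" for g using gauss_q_Zqinv[of 2 g s] by simp
  have "int s \<le> int s * int s" using s by simp
  then have neg: "- int s - 2 * (int s * int s) < 0" "int s - 2 * (int s * int s) < 0" using s by linarith+
  show ?thesis
  proof (cases "even \<alpha>")
    case True
    then obtain g' where "\<alpha> = 2 * g'" by auto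
    moreover define g where "g = nat (g' - 1)"
    ultimately have \<alpha>: "\<alpha> = 2 * (int g + 1)" using assms by auto
    have "icbF_coef j \<alpha> (\<alpha> - 1) = q powi (int s * (1 - \<alpha> - 2 * int s)) * (qrise2 \<alpha> s / qdfact s)"
      using icbF_coef_base_even_even[OF True, of s] by (simp add: j)
    also have "\<dots> = q powi (- int s - 2 * (int s * int s)) * gauss (q powi (- 4)) g s"
      unfolding \<alpha> qrise2_qdfact_gauss q_powi_mult_left by (simp add: algebra_simps)
    finally show ?thesis using qinv_Z_powi_mult[OF neg(1) G] by (simp only:)
  next
    case False
    then obtain g' where "\<alpha> = 2 * g' + 1" by (auto elim: oddE)
    moreover define g where "g = nat g'"
    ultimately have \<alpha>: "\<alpha> = 2 * int g + 1" using assms by auto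
    then have \<alpha>': "\<alpha> + 1 = 2 * (int g + 1)" by simp
    have "icbF_coef j \<alpha> (\<alpha> - 1) = q powi (int s * (2 - \<alpha> - 2 * int s)) * (qrise2 (\<alpha> + 1) s / qdfact s)"
      using icbF_coef_base_odd_even[OF False, of s] by (simp add: j)
    also have "\<dots> = q powi (int s - 2 * (int s * int s)) * gauss (q powi (- 4)) g s"
      unfolding \<alpha>' qrise2_qdfact_gauss q_powi_mult_left by (simp add: \<alpha> algebra_simps)
    finally show ?thesis using qinv_Z_powi_mult[OF neg(2) G] by (simp only:)
  qed
next
  case False
  then show ?thesis by (simp add: icbF_coef_base_odd)
qed

text \<open>Adds up the increments from the base: the new value \<open>M + 1\<close> is at least
  \<alpha>, so the exponent of each increment is negative.\<close>

lemma icbF_coef_qinv: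
  assumes "\<alpha> \<ge> 1" "M \<ge> \<alpha> - 1" "j \<ge> 1"
  shows "icbF_coef j \<alpha> M \<in> qinv_Z"
  using assms(2,3)
proof (induction M arbitrary: j rule: int_ge_induct)
  case base
  then show ?case using icbF_coef_base_qinv assms by auto
next
  case (step M)
  show ?case
    using \<open>j \<ge> 1\<close>
  proof (induction j rule: nat_induct)
    case (Suc j)
    have "icbF_coef j \<alpha> (M + 1) \<in> Zqinv"
      using Suc.IH qinv_Z_subset by (cases "j = 0") auto
    then have "q powi (\<alpha> - 2 * (M + 1) - int (Suc j)) * icbF_coef j \<alpha> (M + 1) \<in> qinv_Z"
      using assms(1) step.hyps by (intro qinv_Z_powi_mult) auto
    then show ?case
      using step.IH[of "Suc j"] icbF_coef_pascal[of j \<alpha> "M + 1"] by (simp add: qinv_Z_add)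
  qed simp
qed

section \<open>Action of the quantum group\<close>

lemma single_Nil_central: "Poly_Mapping.single [] c * x = x * Poly_Mapping.single [] c" for x :: free_alg
  by (induction x rule: free_alg_induct) (simp_all add: mult_single plus_list_def algebra_simps)

lemma single_Nil_one: "Poly_Mapping.single [] 1 = (1 :: free_alg)"
  unfolding single_one[symmetric] zero_list_def ..

lemma uscale_mult_left: "(c \<cdot>\<^sub>U x) * y = c \<cdot>\<^sub>U (x * y)"
  by (induction x rule: uqsl3.abs_induct; induction y rule: uqsl3.abs_induct)
     (simp add: uscale.abs_eq times_uqsl3.abs_eq fscale_def mult.assoc)

lemma uscale_mult_right: "x * (c \<cdot>\<^sub>U y) = c \<cdot>\<^sub>U (x * y)"
proof (induction x rule: uqsl3.abs_induct; induction y rule: uqsl3.abs_induct)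
  fix x y :: free_alg
  have "x * fscale c y = fscale c (x * y)"
    unfolding fscale_def using single_Nil_central[of c x] by (simp flip: mult.assoc)
  then show "abs_uqsl3 x * (c \<cdot>\<^sub>U abs_uqsl3 y) = c \<cdot>\<^sub>U (abs_uqsl3 x * abs_uqsl3 y)"
    by (simp add: uscale.abs_eq times_uqsl3.abs_eq)
qed

lemma uscale_add_left: "(c + d) \<cdot>\<^sub>U x = c \<cdot>\<^sub>U x + d \<cdot>\<^sub>U x"
  by (induction x rule: uqsl3.abs_induct)
     (simp add: uscale.abs_eq plus_uqsl3.abs_eq fscale_def single_add distrib_right)

lemma uscale_uscale: "c \<cdot>\<^sub>U d \<cdot>\<^sub>U x = (c * d) \<cdot>\<^sub>U x"
  by (induction x rule: uqsl3.abs_induct)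
     (simp add: uscale.abs_eq fscale_def mult_single plus_list_def flip: mult.assoc)

lemma uscale_one [simp]: "1 \<cdot>\<^sub>U x = x"
  by (induction x rule: uqsl3.abs_induct) (simp add: uscale.abs_eq fscale_def single_Nil_one)

lemma uscale_zero [simp]: "0 \<cdot>\<^sub>U x = 0"
  using uscale_add_left[of 0 0 x] by simp

lemmas uqsl3_abs_eqs = gen_U.abs_eq uscale.abs_eq times_uqsl3.abs_eq minus_uqsl3.abs_eq
  one_uqsl3.abs_eq zero_uqsl3.abs_eq uqsl3.abs_eq_iff

lemma rel_Kinv_K: "gen_U (Kinv i) * gen_U (K i) = 1"
  unfolding uqsl3_abs_eqs by (rule rel_ideal.relator[OF relators.KinvK])

lemma rel_K_F: "gen_U (K i) * gen_U (F j) = q powi (- cartan i j) \<cdot>\<^sub>U (gen_U (F j) * gen_U (K i))"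
proof -
  have "gen_U (K i) * gen_U (F j) * gen_U (Kinv i) = q powi (- cartan i j) \<cdot>\<^sub>U gen_U (F j)"
    unfolding uqsl3_abs_eqs by (rule rel_ideal.relator[OF relators.KF])
  then have "gen_U (K i) * gen_U (F j) * (gen_U (Kinv i) * gen_U (K i)) = q powi (- cartan i j) \<cdot>\<^sub>U gen_U (F j) * gen_U (K i)"
    by (simp flip: mult.assoc)
  then show ?thesis by (simp add: rel_Kinv_K uscale_mult_left)
qed

lemma rel_E_F: "gen_U (E i) * gen_U (F j) = gen_U (F j) * gen_U (E i)
   + (if i = j then (1 / (q - inverse q)) \<cdot>\<^sub>U (gen_U (K i) - gen_U (Kinv i)) else 0)"
proof -
  have "gen_U (E i) * gen_U (F j) - gen_U (F j) * gen_U (E i)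
    = (if i = j then (1 / (q - inverse q)) \<cdot>\<^sub>U (gen_U (K i) - gen_U (Kinv i)) else 0)"
    unfolding uqsl3_abs_eqs if_distrib[of abs_uqsl3, symmetric]
    by (rule rel_ideal.relator[OF relators.EF])
  then show ?thesis by (simp only: diff_eq_eq add.commute)
qed

context uq_module
begin

abbreviation sc :: "Qq \<Rightarrow> 'v \<Rightarrow> 'v" (infixr \<open>\<star>\<close> 75) where
  "c \<star> v \<equiv> vscale act c v"

lemma act_zero_left [simp]: "act 0 v = 0"
  using act_add_left[of 0 0 v] by simp

lemma act_zero_right [simp]: "act x 0 = 0"
  using act_add_right[of x 0 0] by simp

lemma act_minus_left: "act (- x) v = - act x v"
  using act_add_left[of x "- x" v] by (simp add: eq_neg_iff_add_eq_0 add.commute)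

lemma act_diff_left: "act (x - y) v = act x v - act y v"
  using act_add_left[of x "- y" v] by (simp add: act_minus_left)

lemma act_sum: "act x (sum f A) = (\<Sum>i\<in>A. act x (f i))"
  by (induction A rule: infinite_finite_induct) (simp_all add: act_add_right)

lemma act_uscale: "act (c \<cdot>\<^sub>U x) v = c \<star> act x v"
proof -
  have "c \<cdot>\<^sub>U x = (c \<cdot>\<^sub>U 1) * x" by (simp add: uscale_mult_left)
  then show ?thesis by (simp add: vscale_def act_mult)
qed

lemma act_vscale: "act x (c \<star> v) = c \<star> act x v"
proof -
  have "x * (c \<cdot>\<^sub>U 1) = (c \<cdot>\<^sub>U 1) * x" by (simp add: uscale_mult_left uscale_mult_right)
  then show ?thesis by (simp add: vscale_def flip: act_mult)
qed

end

sublocale uq_module \<subseteq> vs: vector_space "vscale act"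
proof
  show "vscale act a (vscale act b x) = vscale act (a * b) x" for a b x
    by (simp add: vscale_def uscale_mult_left uscale_uscale flip: act_mult)
qed (simp_all add: vscale_def act_add_right act_one uscale_add_left act_add_left)

context uq_module
begin

abbreviation dp :: "uqsl3 \<Rightarrow> int \<Rightarrow> 'v \<Rightarrow> 'v" where
  "dp x r v \<equiv> act (udivpow x r) v"

lemma dp_neg: "r < 0 \<Longrightarrow> dp x r v = 0"
  by (simp add: divpow_def)

lemma dp_0: "dp x 0 v = v"
  by (simp add: divpow_def act_one)

text \<open>Valid for every integer \<open>r\<close>: at \<open>r = -1\<close> the factor
  \<open>[0]\<close> matches the vanishing left-hand side. Later computations can thus ignore the
  range of exponents.\<close>

lemma act_dp: "act x (dp x r v) = qint (r + 1) \<star> dp x (r + 1) v"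
proof -
  consider "r < -1" | "r = -1" | n where "r = int n"
  proof (cases "r \<ge> 0")
    case True
    then show thesis using that(3)[of "nat r"] by simp
  next
    case False
    then show thesis using that(1,2) by linarith
  qed
  then show ?thesis
  proof cases
    case 3
    then show ?thesis
      by (simp add: divpow_def act_uscale act_vscale nat_add_distrib add.commute flip: act_mult)
  qed (simp_all add: dp_neg)
qed

lemma K_dp_F:
  assumes "act (gen_U (K i)) v = q powi \<mu> \<star> v"
  shows "act (gen_U (K i)) (dp (gen_U (F j)) (int r) v) = q powi (\<mu> - cartan i j * int r) \<star> dp (gen_U (F j)) (int r) v"
proof (induction r)
  case 0
  show ?case using assms by (simp add: dp_0)
next
  case (Suc r)
  let ?f = "gen_U (F j)" let ?k = "gen_U (K i)"
  have "qint (int r + 1) \<star> act ?k (dp ?f (int (Suc r)) v) = act ?k (act ?f (dp ?f (int r) v))"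
    by (simp add: act_dp act_vscale add.commute)
  also have "\<dots> = q powi (- cartan i j) \<star> act ?f (act ?k (dp ?f (int r) v))"
  proof -
    have "act ?k (act ?f w) = q powi (- cartan i j) \<star> act ?f (act ?k w)" for w
      by (simp add: rel_K_F act_uscale flip: act_mult)
    then show ?thesis .
  qed
  also have "\<dots> = (q powi (- cartan i j) * q powi (\<mu> - cartan i j * int r) * qint (int r + 1)) \<star> dp ?f (int (Suc r)) v"
    by (simp add: Suc.IH act_dp act_vscale add.commute)
  also have "q powi (- cartan i j) * q powi (\<mu> - cartan i j * int r) = q powi (\<mu> - cartan i j * int (Suc r))"
    by (simp add: q_powi_mult algebra_simps)
  finally have "qint (int r + 1) \<star> act ?k (dp ?f (int (Suc r)) v)
     = qint (int r + 1) \<star> (q powi (\<mu> - cartan i j * int (Suc r)) \<star> dp ?f (int (Suc r)) v)"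
    by (simp add: mult.commute)
  then show ?case by (simp add: vs.scale_left_imp_eq[of "qint (int r + 1)"])
qed

lemma E_dp_F_other:
  assumes "i \<noteq> j"
  shows "act (gen_U (E i)) (dp (gen_U (F j)) r v) = dp (gen_U (F j)) r (act (gen_U (E i)) v)"
proof (cases "r < 0")
  case False
  have c: "gen_U (E i) * gen_U (F j) = gen_U (F j) * gen_U (E i)"
    using assms by (simp add: rel_E_F)
  have "gen_U (E i) * gen_U (F j) ^ n = gen_U (F j) ^ n * gen_U (E i)" for n
    using c by (metis power_commuting_commutes)
  then have "act (gen_U (E i)) (act (gen_U (F j) ^ n) w) = act (gen_U (F j) ^ n) (act (gen_U (E i)) w)" for n w
    by (simp flip: act_mult)
  then show ?thesis using False
    by (simp add: divpow_def act_uscale act_vscale)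
qed (simp add: dp_neg)

lemma Kinv_eigen:
  assumes "act (gen_U (K i)) v = q powi \<mu> \<star> v"
  shows "act (gen_U (Kinv i)) v = q powi (- \<mu>) \<star> v"
proof -
  have "v = act (gen_U (Kinv i)) (act (gen_U (K i)) v)"
    by (simp add: rel_Kinv_K act_one flip: act_mult)
  then have "v = q powi \<mu> \<star> act (gen_U (Kinv i)) v"
    by (simp add: assms act_vscale)
  then have "q powi (- \<mu>) \<star> v = (q powi (- \<mu>) * q powi \<mu>) \<star> act (gen_U (Kinv i)) v"
    by (metis vs.scale_scale)
  then show ?thesis by (simp add: q_powi_mult)
qed

lemma EF_eigen:
  assumes "act (gen_U (K i)) v = q powi \<mu> \<star> v"
  shows "act (gen_U (E i)) (act (gen_U (F i)) v) = act (gen_U (F i)) (act (gen_U (E i)) v) + qint \<mu> \<star> v"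
  using assms Kinv_eigen[OF assms]
  by (simp add: rel_E_F act_add_left act_uscale act_diff_left qint_def vs.scale_right_diff_distrib
      vs.scale_left_diff_distrib diff_divide_distrib flip: act_mult)

end

lemma qint_uminus: "qint (- x) = - qint x"
  by (simp add: qint_def minus_divide_left)

lemma qint_exchange: "qint (x + 1) * qint y - qint x * qint (y + 1) = qint (y - x)"
proof -
  have "qint (x + 1) = q * qint x + q powi (- x)" "qint (y + 1) = q * qint y + q powi (- y)"
    using qint_add[of x 1] qint_add[of y 1] by simp_all
  moreover have "qint (y - x) = q powi (- x) * qint y - q powi (- y) * qint x"
    using qint_add[of y "- x"] by (simp add: qint_uminus)
  ultimately show ?thesis by (simp add: algebra_simps)
qed

context uq_module
begin

text \<open>Writing \<open>[r + 1]\<close> times the divided power as \<open>F\<close> applied to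
  the previous one, \<open>E\<close> is commuted past that \<open>F\<close>. The identity
  \<open>id\<close>, an instance of \<open>qint_exchange\<close>, merges the two
  contributions.\<close>

lemma E_dp_F_same:
  assumes "act (gen_U (K i)) v = q powi \<mu> \<star> v"
  shows "act (gen_U (E i)) (dp (gen_U (F i)) (int r) v)
    = dp (gen_U (F i)) (int r) (act (gen_U (E i)) v) + qint (\<mu> - int r + 1) \<star> dp (gen_U (F i)) (int r - 1) v"
proof (induction r)
  case 0
  show ?case by (simp add: dp_0 dp_neg)
next
  case (Suc r)
  let ?f = "gen_U (F i)" let ?e = "gen_U (E i)"
  have K: "act (gen_U (K i)) (dp ?f (int r) v) = q powi (\<mu> - 2 * int r) \<star> dp ?f (int r) v"
    using K_dp_F[OF assms, of i r] by (simp add: cartan_def)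
  have id: "qint (int r) * qint (\<mu> - int r + 1) + qint (\<mu> - 2 * int r) = qint (int r + 1) * qint (\<mu> - int r)"
    using qint_exchange[of "int r" "\<mu> - int r"] by (simp add: algebra_simps)
  have "qint (int r + 1) \<star> act ?e (dp ?f (int (Suc r)) v) = act ?e (act ?f (dp ?f (int r) v))"
    by (simp add: act_dp act_vscale add.commute)
  also have "\<dots> = act ?f (act ?e (dp ?f (int r) v)) + qint (\<mu> - 2 * int r) \<star> dp ?f (int r) v"
    by (rule EF_eigen[OF K])
  also have "\<dots> = qint (int r + 1) \<star> dp ?f (int r + 1) (act ?e v)
      + (qint (int r) * qint (\<mu> - int r + 1) + qint (\<mu> - 2 * int r)) \<star> dp ?f (int r) v"
    by (simp add: Suc.IH act_add_right act_dp act_vscale vs.scale_left_distrib mult.commute)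
  finally have "qint (int r + 1) \<star> act ?e (dp ?f (int (Suc r)) v)
    = qint (int r + 1) \<star> (dp ?f (int r + 1) (act ?e v) + qint (\<mu> - int r) \<star> dp ?f (int r) v)"
    by (simp add: id vs.scale_right_distrib)
  then have "act ?e (dp ?f (int (Suc r)) v) = dp ?f (int r + 1) (act ?e v) + qint (\<mu> - int r) \<star> dp ?f (int r) v"
    by (rule vs.scale_left_imp_eq[rotated]) simp
  then show ?case by (simp add: add.commute)
qed

definition two_term_coef :: "int \<Rightarrow> int \<Rightarrow> nat \<Rightarrow> nat \<Rightarrow> Qq" where
  "two_term_coef h N a i = q powi (int i * (int a + h) - int (Suc i choose 2)) * qbinom N i"

text \<open>Serves \<open>B1\<close> and \<open>B2\<close> alike: \<open>x\<close> acts on a family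
  by two moves, one raising \<open>r\<close> (the \<open>F\<close> part) and one raising
  \<open>j\<close> (the \<open>E K^-1\<close> part).\<close>

lemma dp_two_term:
  assumes "\<And>r j. act x (u r j) = qint (int r + 1) \<star> u (Suc r) j
      + (q powi (h + int j + 2 * int r) * qint (N + int j + 1)) \<star> u r (Suc j)"
  shows "dp x (int a) (u 0 0) = (\<Sum>i\<le>a. two_term_coef h N a i \<star> u (a - i) i)"
proof (induction a)
  case 0
  show ?case by (simp add: dp_0 two_term_coef_def qbinom_def numeral_2_eq_2)
next
  case (Suc a)
  \<comment> \<open>\<open>u (a + 1 - i) i\<close> is reached from index \<open>i\<close> by the
    first move and from \<open>i - 1\<close> by the second; the conditionals cover the ends of the
    range.\<close>
  have c: "qint (int a + 1) * two_term_coef h N (Suc a) i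
     = (if i \<le> a then two_term_coef h N a i * qint (int (a - i) + 1) else 0)
       + (if i = 0 then 0 else two_term_coef h N a (i - 1) * (q powi (h + int (i - 1) + 2 * int (a - (i - 1))) * qint (N + int i)))"
    if "i \<le> Suc a" for i
  proof -
    have shift: "two_term_coef h N (Suc a) i = q powi (int i) * two_term_coef h N a i"
    proof -
      have e: "int i * (int (Suc a) + h) - int (Suc i choose 2) = int i + (int i * (int a + h) - int (Suc i choose 2))"
        by (simp add: algebra_simps)
      show ?thesis unfolding two_term_coef_def e q_powi_mult[symmetric] by simp
    qed
    \<comment> \<open>These two summands match the two contributions one by one.\<close>
    have s: "qint (int a + 1) * q powi (int i) = qint (int a - int i + 1) + q powi (int a + 1) * qint (int i)"
    proof -
      have "qint (int a + 1) = q powi (- int i) * qint (int a - int i + 1) + q powi (int a - int i + 1) * qint (int i)"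
        using qint_add'[of "int a - int i + 1" "int i"] by (simp add: algebra_simps)
      then have "qint (int a + 1) * q powi (int i) = (q powi (- int i) * q powi (int i)) * qint (int a - int i + 1)
         + (q powi (int a - int i + 1) * q powi (int i)) * qint (int i)"
        by (simp add: algebra_simps)
      then show ?thesis unfolding q_powi_mult by (simp add: algebra_simps)
    qed
    have first: "(if i \<le> a then two_term_coef h N a i * qint (int (a - i) + 1) else 0) = two_term_coef h N a i * qint (int a - int i + 1)"
    proof (cases "i \<le> a")
      case False
      then have "i = Suc a" using that by simp
      then show ?thesis by simp
    qed (simp add: of_nat_diff)
    have second: "(if i = 0 then 0 else two_term_coef h N a (i - 1) * (q powi (h + int (i - 1) + 2 * int (a - (i - 1))) * qint (N + int i)))
      = two_term_coef h N a i * (q powi (int a + 1) * qint (int i))"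
    proof (cases i)
      case (Suc l)
      have Q: "qbinom N l * qint (N + int i) = qbinom N i * qint (int i)"
        by (simp add: qbinom_def Suc qrise_Suc add_ac)
      have e: "int l * (int a + h) - int (Suc l choose 2) + (h + int l + 2 * (int a - int l))
         = int i * (int a + h) - int (Suc i choose 2) + (int a + 1)"
        unfolding Suc Suc_choose_2[of "Suc l"] by (simp add: algebra_simps)
      have "two_term_coef h N a l * (q powi (h + int l + 2 * int (a - l)) * qint (N + int i))
        = (q powi (int l * (int a + h) - int (Suc l choose 2)) * q powi (h + int l + 2 * (int a - int l))) * (qbinom N l * qint (N + int i))"
        using that by (simp add: two_term_coef_def Suc of_nat_diff)
      also have "\<dots> = two_term_coef h N a i * (q powi (int a + 1) * qint (int i))"
        unfolding Q q_powi_mult e unfolding q_powi_mult[symmetric] by (simp add: two_term_coef_def mult_ac)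
      finally show ?thesis by (simp add: Suc)
    qed simp
    have "qint (int a + 1) * two_term_coef h N (Suc a) i = two_term_coef h N a i * (qint (int a + 1) * q powi (int i))"
      by (simp add: shift)
    then show ?thesis unfolding first second s by (simp add: algebra_simps)
  qed
  have "qint (int a + 1) \<star> dp x (int (Suc a)) (u 0 0) = act x (dp x (int a) (u 0 0))"
    by (simp add: act_dp add.commute)
  also have "\<dots> = (\<Sum>i\<le>a. (two_term_coef h N a i * qint (int (a - i) + 1)) \<star> u (Suc a - i) i)
     + (\<Sum>i\<le>a. (two_term_coef h N a i * (q powi (h + int i + 2 * int (a - i)) * qint (N + int i + 1))) \<star> u (a - i) (Suc i))"
    unfolding Suc.IH act_sum
    by (simp add: act_vscale assms vs.scale_right_distrib sum.distrib Suc_diff_le)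
  also have "(\<Sum>i\<le>a. (two_term_coef h N a i * qint (int (a - i) + 1)) \<star> u (Suc a - i) i)
     = (\<Sum>i\<le>Suc a. (if i \<le> a then two_term_coef h N a i * qint (int (a - i) + 1) else 0) \<star> u (Suc a - i) i)"
    by simp
  also have "(\<Sum>i\<le>a. (two_term_coef h N a i * (q powi (h + int i + 2 * int (a - i)) * qint (N + int i + 1))) \<star> u (a - i) (Suc i))
     = (\<Sum>i\<le>Suc a. (if i = 0 then 0 else two_term_coef h N a (i - 1) * (q powi (h + int (i - 1) + 2 * int (a - (i - 1))) * qint (N + int i))) \<star> u (Suc a - i) i)"
    by (subst sum.atMost_Suc_shift) (simp add: add_ac)
  also have "(\<Sum>i\<le>Suc a. (if i \<le> a then two_term_coef h N a i * qint (int (a - i) + 1) else 0) \<star> u (Suc a - i) i) + \<dots>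
     = (\<Sum>i\<le>Suc a. (qint (int a + 1) * two_term_coef h N (Suc a) i) \<star> u (Suc a - i) i)"
    unfolding sum.distrib[symmetric] by (rule sum.cong) (simp_all only: c atMost_iff vs.scale_left_distrib)
  also have "\<dots> = qint (int a + 1) \<star> (\<Sum>i\<le>Suc a. two_term_coef h N (Suc a) i \<star> u (Suc a - i) i)"
    by (simp only: vs.scale_sum_right vs.scale_scale)
  finally show ?case
    by (rule vs.scale_left_imp_eq[rotated]) simp
qed

end

lemma qint_exchange_plus: "qint (x + 1) * qint (y + 1) - qint x * qint y = qint (x + y + 1)"
proof -
  have e: "- (y + 1) + 1 = - y" "- (y + 1) - x = - (x + y + 1)" by simp_all
  show ?thesis
    using qint_exchange[of x "- (y + 1)"] unfolding e qint_uminus by simp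
qed

section \<open>Action on the F-monomials\<close>

context L_module
begin

abbreviation Fm :: "int \<Rightarrow> int \<Rightarrow> int \<Rightarrow> 'v" where
  "Fm \<equiv> Fmon act \<eta>"

lemma Fm_dp: "Fm a b c = dp (gen_U (F I1)) a (dp (gen_U (F I2)) b (dp (gen_U (F I1)) c \<eta>))"
  by (simp add: Fmon_def act_mult)

lemma Fm_neg: "a < 0 \<or> b < 0 \<or> c < 0 \<Longrightarrow> Fm a b c = 0"
  by (auto simp: Fm_dp dp_neg)

lemma F1_Fm: "act (gen_U (F I1)) (Fm a b c) = qint (a + 1) \<star> Fm (a + 1) b c"
  by (simp add: Fm_dp act_dp)

lemma F2_Fm: "act (gen_U (F I2)) (Fm 0 b c) = qint (b + 1) \<star> Fm 0 (b + 1) c"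
  by (simp add: Fm_dp act_dp dp_0)

definition wt :: "idx \<Rightarrow> int \<Rightarrow> int \<Rightarrow> int \<Rightarrow> int" where
  "wt i a b c = (if i = I1 then int m - 2 * a + b - 2 * c else int n + a - 2 * b + c)"

lemma K_eta: "act (gen_U (K i)) \<eta> = q powi (wt i 0 0 0) \<star> \<eta>"
  by (cases i) (simp_all add: wt_def K1_eta K2_eta)

lemma K_Fm: "act (gen_U (K i)) (Fm a b c) = q powi (wt i a b c) \<star> Fm a b c"
proof (cases "a < 0 \<or> b < 0 \<or> c < 0")
  case False
  then obtain a' b' c' where abc: "a = int a'" "b = int b'" "c = int c'"
    by (metis not_less nonneg_int_cases)
  have "act (gen_U (K i)) (Fm a b c) = q powi (wt i 0 0 0 - cartan i I1 * int c' - cartan i I2 * int b' - cartan i I1 * int a') \<star> Fm a b c"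
    unfolding Fm_dp abc by (intro K_dp_F K_eta)
  also have "wt i 0 0 0 - cartan i I1 * int c' - cartan i I2 * int b' - cartan i I1 * int a' = wt i a b c"
    by (cases i) (simp_all add: wt_def cartan_def abc)
  finally show ?thesis .
qed (simp add: Fm_neg)

lemma Kinv_Fm: "act (gen_U (Kinv i)) (Fm a b c) = q powi (- wt i a b c) \<star> Fm a b c"
  by (rule Kinv_eigen[OF K_Fm])

text \<open>\<open>E1\<close> kills \<eta> and commutes with the middle block, so one term arises
  from each of the two \<open>F1\<close> blocks. For negative exponents all monomials involved
  vanish.\<close>

lemma E1_Fm: "act (gen_U (E I1)) (Fm a b c) = qint (int m - c + 1) \<star> Fm a b (c - 1)
   + qint (int m + b - 2 * c - a + 1) \<star> Fm (a - 1) b c"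
proof (cases "a < 0 \<or> b < 0 \<or> c < 0")
  case False
  then obtain a' b' c' where abc: "a = int a'" "b = int b'" "c = int c'"
    by (metis not_less nonneg_int_cases)
  let ?f1 = "gen_U (F I1)" let ?f2 = "gen_U (F I2)" let ?e = "gen_U (E I1)"
  have 1: "act ?e (dp ?f1 c \<eta>) = qint (int m - c + 1) \<star> dp ?f1 (c - 1) \<eta>"
    using E_dp_F_same[OF K_eta, of I1 c'] by (simp add: E_eta abc wt_def)
  have 2: "act ?e (dp ?f2 b (dp ?f1 c \<eta>)) = qint (int m - c + 1) \<star> dp ?f2 b (dp ?f1 (c - 1) \<eta>)"
    by (simp add: E_dp_F_other 1 act_vscale)
  have "act (gen_U (K I1)) (dp ?f2 b (dp ?f1 c \<eta>)) = q powi (wt I1 0 b c) \<star> dp ?f2 b (dp ?f1 c \<eta>)"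
    using K_Fm[of I1 0 b c] by (simp add: Fm_dp dp_0)
  from E_dp_F_same[OF this, of a'] show ?thesis
    by (simp add: 2[unfolded abc] abc Fm_dp act_vscale wt_def algebra_simps)
qed (auto simp: Fm_neg)

lemma E2_Fm: "act (gen_U (E I2)) (Fm a b c) = qint (int n + c - b + 1) \<star> Fm a (b - 1) c"
proof (cases "a < 0 \<or> b < 0 \<or> c < 0")
  case False
  then obtain a' b' c' where abc: "a = int a'" "b = int b'" "c = int c'"
    by (metis not_less nonneg_int_cases)
  let ?f1 = "gen_U (F I1)" let ?f2 = "gen_U (F I2)" let ?e = "gen_U (E I2)"
  have "act (gen_U (K I2)) (dp ?f1 c \<eta>) = q powi (wt I2 0 0 c) \<star> dp ?f1 c \<eta>"
    using K_Fm[of I2 0 0 c] by (simp add: Fm_dp dp_0)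
  from E_dp_F_same[OF this, of b'] show ?thesis
    by (simp add: Fm_dp abc E_dp_F_other E_eta act_vscale wt_def algebra_simps)
qed (auto simp: Fm_neg)

lemma B_Fm: "act (B \<sigma> i) v = act (gen_U (F i)) v + q powi (\<sigma> i) \<star> act (gen_U (E (tau i))) (act (gen_U (Kinv i)) v)"
  by (simp add: B_def act_add_left act_uscale act_mult)

lemma B1_dp:
  "dp (B \<sigma> I1) (int a) (Fm 0 b c)
    = (\<Sum>i\<le>a. two_term_coef (\<sigma> I1 - int m - b + 2 * c) (int n + c - b) a i \<star> Fm (int a - int i) (b - int i) c)"
proof -
  let ?h = "\<sigma> I1 - int m - b + 2 * c" and ?N = "int n + c - b"
  let ?u = "\<lambda>r j. Fm (int r) (b - int j) c"
  have "act (B \<sigma> I1) (?u r j) = qint (int r + 1) \<star> ?u (Suc r) j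
      + (q powi (?h + int j + 2 * int r) * qint (?N + int j + 1)) \<star> ?u r (Suc j)" for r j
  proof -
    have "q powi \<sigma> I1 * q powi (- wt I1 (int r) (b - int j) c) = q powi (?h + int j + 2 * int r)"
      unfolding q_powi_mult by (simp add: wt_def algebra_simps)
    moreover have "int n + c - (b - int j) + 1 = ?N + int j + 1" "b - int j - 1 = b - int (Suc j)" by simp_all
    ultimately show ?thesis
      by (simp only: B_Fm tau.simps Kinv_Fm act_vscale E2_Fm F1_Fm vs.scale_scale mult.assoc[symmetric])
        (simp add: add.commute)
  qed
  from dp_two_term[where u = ?u, OF this, of a] show ?thesis
    by (simp add: of_nat_diff)
qed

lemma B2_dp:
  "dp (B \<sigma> I2) (int b) (Fm 0 0 c)
    = (\<Sum>j\<le>b. two_term_coef (\<sigma> I2 - int n - c) (int m - c) b j \<star> Fm 0 (int b - int j) (c - int j))"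
proof -
  let ?h = "\<sigma> I2 - int n - c" and ?N = "int m - c"
  let ?u = "\<lambda>r j. Fm 0 (int r) (c - int j)"
  have "act (B \<sigma> I2) (?u r j) = qint (int r + 1) \<star> ?u (Suc r) j
      + (q powi (?h + int j + 2 * int r) * qint (?N + int j + 1)) \<star> ?u r (Suc j)" for r j
  proof -
    have "q powi \<sigma> I2 * q powi (- wt I2 0 (int r) (c - int j)) = q powi (?h + int j + 2 * int r)"
      unfolding q_powi_mult by (simp add: wt_def algebra_simps)
    moreover have "int m - (c - int j) + 1 = ?N + int j + 1" "c - int j - 1 = c - int (Suc j)" by simp_all
    \<comment> \<open>The second term of \<open>E1_Fm\<close> would lower the first exponent, which
      is already 0.\<close>
    moreover have "Fm (0 - 1) (int r) (c - int j) = 0" by (simp add: Fm_neg)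
    ultimately show ?thesis
      by (simp only: B_Fm tau.simps Kinv_Fm act_vscale E1_Fm F2_Fm vs.scale_scale mult.assoc[symmetric] vs.scale_zero_right add_0_right)
        (simp add: add.commute)
  qed
  from dp_two_term[where u = ?u, OF this, of b] show ?thesis
    by (simp add: of_nat_diff)
qed

text \<open>Every term involving \<open>E2\<close> would lower the middle exponent below 0.\<close>

lemma B1_dp_eta: "dp (B \<sigma> I1) (int c) \<eta> = Fm 0 0 (int c)"
proof -
  have eta: "Fm 0 0 0 = \<eta>" by (simp add: Fm_dp dp_0)
  have "dp (B \<sigma> I1) (int c) (Fm 0 0 0) = (\<Sum>i\<le>c. two_term_coef (\<sigma> I1 - int m) (int n) c i \<star> Fm (int c - int i) (- int i) 0)"
    using B1_dp[of \<sigma> c 0 0] by simp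
  also have "\<dots> = (\<Sum>i\<in>{0}. two_term_coef (\<sigma> I1 - int m) (int n) c i \<star> Fm (int c - int i) (- int i) 0)"
    by (rule sum.mono_neutral_right) (auto simp: Fm_neg)
  also have "\<dots> = Fm 0 0 (int c)"
    by (simp add: two_term_coef_def qbinom_def numeral_2_eq_2 Fm_dp dp_0)
  finally show ?thesis by (simp add: eta)
qed

text \<open>In use, \<open>e\<close> drops by \<open>k\<close> when \<open>(b, c)\<close> becomes
  \<open>(b - k, c - k)\<close>, while \<open>N = n + c - b\<close> stays. Replacing
  \<open>j\<close> by \<open>j - k\<close> as well therefore changes nothing.\<close>

definition outer_coef0 :: "int \<Rightarrow> int \<Rightarrow> nat \<Rightarrow> int \<Rightarrow> Qq" where
  "outer_coef0 e N i j = q powi (int i * (e - j) - int (Suc i choose 2)) * qbinom N i"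

lemma Bmon_expansion:
  assumes "c \<le> b"
  shows "Bmon \<sigma> act \<eta> (int a) (int b) (int c)
    = (\<Sum>i\<le>a. \<Sum>j\<le>c. (outer_coef0 (int a + \<sigma> I1 - int m - int b + 2 * int c) (int n + int c - int b) i (int j)
        * BF_coef j (int m - int n + int b - 2 * int c + \<sigma> I2) (int m - int c))
        \<star> Fm (int a - int i) (int b - int i - int j) (int c - int j))"
proof -
  let ?I = "outer_coef0 (int a + \<sigma> I1 - int m - int b + 2 * int c) (int n + int c - int b)"
  let ?Q = "\<lambda>j. BF_coef j (int m - int n + int b - 2 * int c + \<sigma> I2) (int m - int c)"
  have Y: "two_term_coef (\<sigma> I2 - int n - int c) (int m - int c) b j = ?Q j" for j
    by (simp add: two_term_coef_def BF_coef_def algebra_simps)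
  have X: "two_term_coef (\<sigma> I1 - int m - (int b - int j) + 2 * (int c - int j)) (int n + (int c - int j) - (int b - int j)) a i
      = ?I i (int j)" for i j
    by (simp add: two_term_coef_def outer_coef0_def algebra_simps)
  have "Bmon \<sigma> act \<eta> (int a) (int b) (int c) = dp (B \<sigma> I1) (int a) (dp (B \<sigma> I2) (int b) (Fm 0 0 (int c)))"
    by (simp add: Bmon_def act_mult B1_dp_eta)
  also have "\<dots> = (\<Sum>j\<le>b. ?Q j \<star> dp (B \<sigma> I1) (int a) (Fm 0 (int b - int j) (int c - int j)))"
    by (simp add: B2_dp act_sum act_vscale Y)
  also have "\<dots> = (\<Sum>j\<le>b. \<Sum>i\<le>a. (?I i (int j) * ?Q j) \<star> Fm (int a - int i) (int b - int i - int j) (int c - int j))"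
    unfolding B1_dp X vs.scale_sum_right vs.scale_scale
    by (intro sum.cong refl) (simp only: mult.commute diff_diff_eq add.commute)
  \<comment> \<open>Terms with \<open>j > c\<close> vanish, and \<open>c \<le> b\<close> keeps the
    shorter range inside the original one.\<close>
  also have "\<dots> = (\<Sum>j\<le>c. \<Sum>i\<le>a. (?I i (int j) * ?Q j) \<star> Fm (int a - int i) (int b - int i - int j) (int c - int j))"
    by (rule sum.mono_neutral_right) (use assms in \<open>auto simp: Fm_neg\<close>)
  finally show ?thesis
    by (subst sum.swap)
qed

text \<open>\<open>E2\<close> and then \<open>E1\<close> lead the monomial back to \<eta>, with
  coefficients that the two bounds keep nonzero.\<close>

lemma Fm0_nonzero:
  assumes "s \<le> m" "b \<le> n + s"
  shows "Fm 0 (int b) (int s) \<noteq> 0"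
  using assms(2)
proof (induction b)
  case 0
  show ?case using assms(1)
  proof (induction s)
    case 0
    show ?case by (simp add: Fm_dp dp_0 eta_nonzero)
  next
    case (Suc s)
    have "act (gen_U (E I1)) (Fm 0 0 (int (Suc s))) = qint (int m - int s) \<star> Fm 0 0 (int s)"
      by (simp add: E1_Fm Fm_neg)
    moreover have "qint (int m - int s) \<star> Fm 0 0 (int s) \<noteq> 0" using Suc by simp
    ultimately show ?case by force
  qed
next
  case (Suc b)
  have "act (gen_U (E I2)) (Fm 0 (int (Suc b)) (int s)) = qint (int n + int s - int b) \<star> Fm 0 (int b) (int s)"
    by (simp add: E2_Fm algebra_simps)
  moreover have "qint (int n + int s - int b) \<star> Fm 0 (int b) (int s) \<noteq> 0" using Suc by simp
  ultimately show ?case by force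
qed

text \<open>Applying \<open>E\<^sub>2 E\<^sub>1\<close> and \<open>E\<^sub>1 E\<^sub>2\<close> to a linear relation produces two relations one level up; by
  induction their coefficients vanish, and \<open>[A] [C] \<noteq> [A + 1] [C + 1]\<close> decouples the unknowns.\<close>

lemma Fm_independent:
  assumes "s \<le> b"
    and "\<And>x. x \<le> s \<Longrightarrow> p x \<noteq> 0 \<Longrightarrow> s - x \<le> m \<and> b \<le> n + (s - x)"
    and "(\<Sum>x\<le>s. p x \<star> Fm (int x) (int b) (int s - int x)) = 0"
    and "x \<le> s"
  shows "p x = 0"
  using assms
proof (induction s arbitrary: b p x)
  case 0
  then show ?case using Fm0_nonzero[of 0 b] by fastforce
next
  case (Suc s)
  obtain b' where b: "b = Suc b'" and b': "s \<le> b'" using Suc.prems(1) by (cases b) auto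
  let ?e1 = "gen_U (E I1)" and ?e2 = "gen_U (E I2)"
  let ?v = "\<lambda>x. Fm (int x) (int b') (int s - int x)"
  define y where "y x = int s - int x" for x
  have supp: "int (Suc s) - int x \<le> int m \<and> int b \<le> int n + (int (Suc s) - int x)" if "x \<le> Suc s" "p x \<noteq> 0" for x
    using Suc.prems(2)[OF that] that by (simp add: of_nat_diff) linarith
  \<comment> \<open>Coefficients of the relation after \<open>E2 E1\<close>; \<open>p2\<close>
    belongs to \<open>E1 E2\<close>. Each mixes \<open>p x\<close> and
    \<open>p (x + 1)\<close>.\<close>
  define p1 where "p1 x = p x * (qint (int m - y x) * qint (int n + y x - int b'))
     + p (Suc x) * (qint (int m + int b' - 2 * y x - int x + 1) * qint (int n + y x - int b'))" for x
  define p2 where "p2 x = p x * (qint (int n + y x - int b' + 1) * qint (int m - y x))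
     + p (Suc x) * (qint (int n + y x - int b') * qint (int m + int b' - 2 * y x - int x))" for x
  have split: "(\<Sum>x\<le>Suc s. p x \<star> (f x \<star> Fm (int x) (int b') (int (Suc s) - int x - 1)
      + g x \<star> Fm (int x - 1) (int b') (int (Suc s) - int x)))
      = (\<Sum>x\<le>s. (p x * f x + p (Suc x) * g (Suc x)) \<star> ?v x)" for f g
  proof -
    have "(\<Sum>x\<le>Suc s. p x \<star> (f x \<star> Fm (int x) (int b') (int (Suc s) - int x - 1)
      + g x \<star> Fm (int x - 1) (int b') (int (Suc s) - int x)))
      = (\<Sum>x\<le>Suc s. (p x * f x) \<star> Fm (int x) (int b') (int (Suc s) - int x - 1))
      + (\<Sum>x\<le>Suc s. (p x * g x) \<star> Fm (int x - 1) (int b') (int (Suc s) - int x))"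
      by (simp only: vs.scale_right_distrib sum.distrib vs.scale_scale)
    also have "(\<Sum>x\<le>Suc s. (p x * f x) \<star> Fm (int x) (int b') (int (Suc s) - int x - 1)) = (\<Sum>x\<le>s. (p x * f x) \<star> ?v x)"
      by (simp add: Fm_neg)
    also have "(\<Sum>x\<le>Suc s. (p x * g x) \<star> Fm (int x - 1) (int b') (int (Suc s) - int x))
       = (\<Sum>x\<le>s. (p (Suc x) * g (Suc x)) \<star> ?v x)"
      by (subst sum.atMost_Suc_shift) (simp add: Fm_neg)
    finally show ?thesis by (simp add: sum.distrib vs.scale_left_distrib)
  qed
  have "0 = act ?e2 (act ?e1 (\<Sum>x\<le>Suc s. p x \<star> Fm (int x) (int b) (int (Suc s) - int x)))"
    by (simp only: Suc.prems(3) act_zero_right)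
  also have "\<dots> = (\<Sum>x\<le>Suc s. p x \<star> (
        (qint (int m - y x) * qint (int n + y x - int b')) \<star> Fm (int x) (int b') (int (Suc s) - int x - 1)
      + (qint (int m + int b' - 2 * y x - int x) * qint (int n + y x - int b' + 1)) \<star> Fm (int x - 1) (int b') (int (Suc s) - int x)))"
    by (simp only: act_sum act_vscale E1_Fm act_add_right E2_Fm vs.scale_scale)
       (simp add: y_def b algebra_simps)
  also have "\<dots> = (\<Sum>x\<le>s. p1 x \<star> ?v x)"
    unfolding split p1_def by (simp add: y_def algebra_simps)
  finally have s1: "(\<Sum>x\<le>s. p1 x \<star> ?v x) = 0" by simp
  have "0 = act ?e1 (act ?e2 (\<Sum>x\<le>Suc s. p x \<star> Fm (int x) (int b) (int (Suc s) - int x)))"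
    by (simp only: Suc.prems(3) act_zero_right)
  also have "\<dots> = (\<Sum>x\<le>Suc s. p x \<star> (
        (qint (int n + y x - int b' + 1) * qint (int m - y x)) \<star> Fm (int x) (int b') (int (Suc s) - int x - 1)
      + (qint (int n + y x - int b' + 1) * qint (int m + int b' - 2 * y x - int x - 1)) \<star> Fm (int x - 1) (int b') (int (Suc s) - int x)))"
    by (simp only: act_sum act_vscale E1_Fm act_add_right E2_Fm vs.scale_scale)
       (simp add: y_def b vs.scale_right_distrib algebra_simps)
  also have "\<dots> = (\<Sum>x\<le>s. p2 x \<star> ?v x)"
    unfolding split p2_def by (simp add: y_def algebra_simps)
  finally have s2: "(\<Sum>x\<le>s. p2 x \<star> ?v x) = 0" by simp
  have range: "s - x \<le> m \<and> b' \<le> n + (s - x)" if "x \<le> s" and "p1 x \<noteq> 0 \<or> p2 x \<noteq> 0" for x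
  proof -
    have "p x \<noteq> 0 \<and> int m \<noteq> y x \<or> p (Suc x) \<noteq> 0" using that(2) by (auto simp: p1_def p2_def)
    then have "y x \<le> int m \<and> int b' \<le> int n + y x"
    proof
      assume "p x \<noteq> 0 \<and> int m \<noteq> y x"
      then show ?thesis using supp[of x] that(1) by (auto simp: y_def b)
    next
      assume "p (Suc x) \<noteq> 0"
      then show ?thesis using supp[of "Suc x"] that(1) by (auto simp: y_def b)
    qed
    then show ?thesis using that(1) by (simp add: y_def of_nat_diff) linarith
  qed
  have p1: "p1 x = 0" if "x \<le> s" for x
    by (rule Suc.IH[OF b' _ s1 that]) (use range in blast)
  have p2: "p2 x = 0" if "x \<le> s" for x
    by (rule Suc.IH[OF b' _ s2 that]) (use range in blast)
  have pSuc: "p (Suc x) = 0" if "x \<le> s" for x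
  proof (rule ccontr)
    assume nz: "p (Suc x) \<noteq> 0"
    \<comment> \<open>On the support of \<open>p (x + 1)\<close>, \<open>A\<close> is positive and
      \<open>C\<close> nonnegative, so \<open>[A]\<close> can be cancelled in
      \<open>p1 x = 0\<close> and \<open>[A + C + 1]\<close> is nonzero.\<close>
    define A C where "A = int n + y x - int b'" and "C = int m + int b' - 2 * y x - int x"
    have A: "A > 0" "y x \<le> int m" using supp[OF _ nz] that by (auto simp: A_def y_def b)
    have "C = (int m - y x) + (int b' - int s)" by (simp add: C_def y_def)
    then have C: "C \<ge> 0" using A(2) b' by simp
    have "qint A * (p x * qint (int m - y x) + p (Suc x) * qint (C + 1)) = 0"
      using p1[OF that] by (simp add: p1_def A_def C_def algebra_simps)
    then have 1: "p x * qint (int m - y x) = - (p (Suc x) * qint (C + 1))"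
      using A by (simp add: add_eq_0_iff2)
    have 2: "(p x * qint (int m - y x)) * qint (A + 1) + p (Suc x) * (qint A * qint C) = 0"
      using p2[OF that] by (simp add: p2_def A_def C_def algebra_simps)
    have "p (Suc x) * (qint (A + 1) * qint (C + 1) - qint A * qint C)
       = - ((p x * qint (int m - y x)) * qint (A + 1) + p (Suc x) * (qint A * qint C))"
      unfolding 1 by (simp add: algebra_simps)
    also have "\<dots> = 0" by (simp only: 2 minus_zero)
    finally have "p (Suc x) * (qint (A + 1) * qint (C + 1) - qint A * qint C) = 0" .
    moreover have "qint (A + 1) * qint (C + 1) - qint A * qint C = qint (A + C + 1)"
      by (rule qint_exchange_plus)
    ultimately show False using nz A C by simp
  qed
  have p0: "p 0 = 0"
  proof (rule ccontr)
    assume nz: "p 0 \<noteq> 0"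
    have "(\<Sum>x\<le>Suc s. p x \<star> Fm (int x) (int b) (int (Suc s) - int x)) = p 0 \<star> Fm 0 (int b) (int (Suc s))"
      by (subst sum.atMost_Suc_shift) (simp add: pSuc)
    then show False
      using nz Suc.prems(2)[of 0] Suc.prems(3) Fm0_nonzero[of "Suc s" b] by simp
  qed
  show ?case using p0 pSuc Suc.prems(4) by (cases x) auto
qed

end

section \<open>Uniqueness of the i-canonical basis\<close>

context uq_module
begin

lemma eigenvectors_independent:
  assumes "finite T" "\<And>t. t \<in> T \<Longrightarrow> act x (v t) = \<mu> t \<star> v t" "inj_on \<mu> T" "(\<Sum>t\<in>T. v t) = 0" "t \<in> T"
  shows "v t = 0"
  using assms
proof (induction T arbitrary: v t rule: finite_induct)
  case (insert s T)
  let ?v = "\<lambda>t. (\<mu> t - \<mu> s) \<star> v t"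
  have "(\<Sum>t\<in>insert s T. ?v t) = act x (\<Sum>t\<in>insert s T. v t) - \<mu> s \<star> (\<Sum>t\<in>insert s T. v t)"
    unfolding act_sum vs.scale_sum_right sum_subtractf[symmetric]
    by (rule sum.cong) (simp_all only: insert.prems(1) vs.scale_left_diff_distrib)
  also have "\<dots> = 0" by (simp only: insert.prems(3) act_zero_right vs.scale_zero_right diff_zero)
  finally have sum0: "(\<Sum>t\<in>T. ?v t) = 0" using insert.hyps by simp
  have "?v t = 0" if "t \<in> T" for t
  proof (rule insert.IH[OF _ _ sum0 that])
    show "act x (?v t) = \<mu> t \<star> ?v t" if "t \<in> T" for t
      using insert.prems(1)[of t] that by (simp add: act_vscale mult.commute)
    show "inj_on \<mu> T" using insert.prems(2) by simp
  qed
  moreover have "\<mu> t \<noteq> \<mu> s" if "t \<in> T" for t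
    using insert.prems(2) insert.hyps that by (auto simp: inj_on_def)
  ultimately have "v t = 0" if "t \<in> T" for t using that by simp
  then show ?case using insert.prems(3,4) insert.hyps by auto
qed simp

text \<open>The coefficients are indexed by \<open>S\<close> and not by the image, which asks no
  injectivity of \<open>f\<close>.\<close>

lemma span_image_finite:
  assumes "finite S" "w \<in> vs.span (f ` S)"
  obtains r where "w = (\<Sum>g\<in>S. r g \<star> f g)"
proof -
  have "\<exists>r. w = (\<Sum>g\<in>S. r g \<star> f g)"
    using assms(2)
  proof (induction rule: vs.span_induct_alt)
    case base
    show ?case by (rule exI[of _ "\<lambda>_. 0"]) simp
  next
    case (step c x y)
    then obtain g r where g: "g \<in> S" "x = f g" and y: "y = (\<Sum>g\<in>S. r g \<star> f g)" by auto
    have "c \<star> x = (\<Sum>h\<in>S. (if h = g then c else 0) \<star> f h)"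
      using g assms(1) by (simp add: if_distrib[of "\<lambda>c. c \<star> _"] sum.delta cong: if_cong)
    then have "c \<star> x + y = (\<Sum>h\<in>S. ((if h = g then c else 0) + r h) \<star> f h)"
      unfolding y by (simp add: vs.scale_left_distrib sum.distrib)
    then show ?case by (rule exI[where x = "\<lambda>h. (if h = g then c else 0) + r h"])
  qed
  then show thesis using that by blast
qed

end

context L_module
begin

text \<open>Monomials are addressed by their displacement from \<open>(a, b, c)\<close>; the bar
  involution will be unitriangular with respect to the degree of the displacement.\<close>

definition fm :: "nat \<Rightarrow> nat \<Rightarrow> nat \<Rightarrow> nat \<times> nat \<Rightarrow> 'v" where
  "fm a b c g = Fm (int a - int (fst g)) (int b - int (fst g) - int (snd g)) (int c - int (snd g))"

definition grid :: "nat \<Rightarrow> nat \<Rightarrow> (nat \<times> nat) set" where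
  "grid a c = {..a} \<times> {..c}"

abbreviation deg :: "nat \<times> nat \<Rightarrow> nat" where
  "deg g \<equiv> fst g + snd g"

lemma finite_grid [simp]: "finite (grid a c)"
  by (simp add: grid_def)

lemma fm_outside: "g \<notin> grid a c \<Longrightarrow> fm a b c g = 0"
  by (cases g) (auto simp: fm_def grid_def Fm_neg)

text \<open>The weight under \<open>K1\<close> grows with \<open>deg g\<close>, so \<open>K1\<close>
  separates the degrees. Within one degree the first exponent determines the monomial and
  \<open>Fm_independent\<close> applies.\<close>

lemma fm_independent:
  assumes "a + c \<le> b" "c \<le> m" "b \<le> n + c"
    and "(\<Sum>g\<in>grid a c. p g \<star> fm a b c g) = 0" "g \<in> grid a c"
  shows "p g = 0"
proof -
  define v where "v t = (\<Sum>g | g \<in> grid a c \<and> deg g = t. p g \<star> fm a b c g)" for t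
  have "(\<Sum>t\<le>a + c. v t) = (\<Sum>g\<in>grid a c. p g \<star> fm a b c g)"
    unfolding v_def by (rule sum.group) (auto simp: grid_def)
  then have sum0: "(\<Sum>t\<le>a + c. v t) = 0" using assms(4) by simp
  have eigen: "act (gen_U (K I1)) (v t) = q powi (int m - 2 * int a + int b - 2 * int c + int t) \<star> v t" for t
    unfolding v_def act_sum vs.scale_sum_right
    by (rule sum.cong) (auto simp: act_vscale fm_def K_Fm wt_def algebra_simps)
  define t where "t = deg g"
  have "v t = 0"
    by (rule eigenvectors_independent[OF _ eigen _ sum0])
       (use assms(5) in \<open>auto simp: t_def grid_def inj_on_def dest: q_powi_inj\<close>)
  \<comment> \<open>In degree \<open>t\<close> the middle exponent is \<open>b - t\<close> and the
    outer ones sum to \<open>s\<close>. \<open>P\<close> indexes the coefficients by the first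
    exponent and is 0 off the grid.\<close>
  define s where "s = a + c - t"
  define P where "P x = (if x \<le> a \<and> a - x \<le> t \<and> t - (a - x) \<le> c then p (a - x, t - (a - x)) else 0)" for x
  have ts: "t \<le> a + c" using assms(5) by (auto simp: t_def grid_def)
  have "(\<Sum>x\<le>s. P x \<star> Fm (int x) (int (b - t)) (int s - int x))
     = (\<Sum>x\<in>{x. x \<le> a \<and> a - x \<le> t \<and> t - (a - x) \<le> c}. P x \<star> Fm (int x) (int (b - t)) (int s - int x))"
    by (rule sum.mono_neutral_right) (use ts in \<open>auto simp: P_def s_def\<close>)
  also have "\<dots> = v t"
    unfolding v_def
    by (rule sum.reindex_bij_witness[of _ "\<lambda>g. a - fst g" "\<lambda>x. (a - x, t - (a - x))"])
       (use ts assms(1) in \<open>auto simp: P_def s_def grid_def fm_def of_nat_diff algebra_simps\<close>)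
  finally have 0: "(\<Sum>x\<le>s. P x \<star> Fm (int x) (int (b - t)) (int s - int x)) = 0"
    using \<open>v t = 0\<close> by simp
  have "P (a - fst g) = 0"
    by (rule Fm_independent[OF _ _ 0])
       (use ts assms in \<open>auto simp: P_def s_def t_def grid_def split: if_splits\<close>)
  then show ?thesis using assms(5) by (auto simp: P_def t_def grid_def)
qed

text \<open>Arbitrary finite index sets reduce to the grid, outside which the monomials
  vanish.\<close>

lemma icb2_coset_iff:
  assumes "a + c \<le> b"
  shows "v \<in> icb2_coset act \<eta> (int a) (int b) (int c) \<longleftrightarrow>
    (\<exists>p. (\<forall>g\<in>grid a c. p g \<in> qinv_Z) \<and> p (0, 0) = 0 \<and> v = fm a b c (0, 0) + (\<Sum>g\<in>grid a c. p g \<star> fm a b c g))"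
    (is "?L \<longleftrightarrow> ?R")
proof
  assume ?L
  then obtain S p where S: "finite S" "(0, 0) \<notin> S" "\<forall>(x, y)\<in>S. p x y \<in> qinv_Z"
    and v: "v = Fm (int a) (int b) (int c) + (\<Sum>(x, y)\<in>S. p x y \<star> Fm (int a - int x) (int b - int x - int y) (int c - int y))"
    unfolding icb2_coset_def by blast
  define r where "r g = (if g \<in> S then p (fst g) (snd g) else 0)" for g
  have "(\<Sum>(x, y)\<in>S. p x y \<star> Fm (int a - int x) (int b - int x - int y) (int c - int y))
     = (\<Sum>g\<in>S. r g \<star> fm a b c g)"
    by (rule sum.cong) (auto simp: r_def fm_def)
  also have "\<dots> = (\<Sum>g\<in>S \<union> grid a c. r g \<star> fm a b c g)"
    by (rule sum.mono_neutral_left) (use S in \<open>auto simp: r_def\<close>)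
  also have "\<dots> = (\<Sum>g\<in>grid a c. r g \<star> fm a b c g)"
    by (rule sum.mono_neutral_right) (use S in \<open>auto simp: fm_outside\<close>)
  finally have "v = fm a b c (0, 0) + (\<Sum>g\<in>grid a c. r g \<star> fm a b c g)"
    by (simp add: v fm_def)
  moreover have "\<forall>g\<in>grid a c. r g \<in> qinv_Z" "r (0, 0) = 0"
    using S by (auto simp: r_def)
  ultimately show ?R by blast
next
  assume ?R
  then obtain p where p: "\<forall>g\<in>grid a c. p g \<in> qinv_Z" "p (0, 0) = 0"
    and v: "v = fm a b c (0, 0) + (\<Sum>g\<in>grid a c. p g \<star> fm a b c g)" by blast
  have "(\<Sum>g\<in>grid a c. p g \<star> fm a b c g) = (\<Sum>g\<in>grid a c - {(0, 0)}. p g \<star> fm a b c g)"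
    by (rule sum.mono_neutral_right) (auto simp: p)
  also have "\<dots> = (\<Sum>(x, y)\<in>grid a c - {(0, 0)}. p (x, y) \<star> Fm (int a - int x) (int b - int x - int y) (int c - int y))"
    by (rule sum.cong) (auto simp: fm_def)
  finally show ?L
    unfolding icb2_coset_def v
    by (auto simp: fm_def intro!: exI[of _ "grid a c - {(0, 0)}"] exI[of _ "\<lambda>x y. p (x, y)"] p(1)[rule_format])
qed

end

text \<open>Keeps of the bar involution its antilinearity and the invariance of the B-monomials, on
  which the uniqueness argument runs.\<close>

locale bar_L_module = L_module act m n \<eta>
  for act :: "uqsl3 \<Rightarrow> 'v::ab_group_add \<Rightarrow> 'v" and m n \<eta> +
  fixes \<sigma> :: "idx \<Rightarrow> int" and \<psi>L :: "'v \<Rightarrow> 'v"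
  assumes \<psi>L_add: "\<psi>L (v + w) = \<psi>L v + \<psi>L w"
    and \<psi>L_vscale: "\<psi>L (vscale act d v) = vscale act (qbar d) (\<psi>L v)"
    and \<psi>L_Bmon: "\<psi>L (Bmon \<sigma> act \<eta> x y z) = Bmon \<sigma> act \<eta> x y z"
begin

lemma \<psi>L_0 [simp]: "\<psi>L 0 = 0"
  using \<psi>L_add[of 0 0] by simp

lemma \<psi>L_diff: "\<psi>L (v - w) = \<psi>L v - \<psi>L w"
  using \<psi>L_add[of "v - w" w] by simp

lemma \<psi>L_sum: "\<psi>L (sum f A) = (\<Sum>i\<in>A. \<psi>L (f i))"
  by (induction A rule: infinite_finite_induct) (simp_all add: \<psi>L_add)

text \<open>Unitriangularity: the term \<open>(0, 0)\<close> of the expansion has coefficient 1, and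
  all others have larger degree.\<close>

lemma Bmon_fm:
  assumes "a + c \<le> b" "g \<in> grid a c"
  shows "Bmon \<sigma> act \<eta> (int a - int (fst g)) (int b - int (fst g) - int (snd g)) (int c - int (snd g)) - fm a b c g
    \<in> vs.span (fm a b c ` {h \<in> grid a c. deg h > deg g})"
proof -
  obtain x y where g: "g = (x, y)" "x \<le> a" "y \<le> c" using assms(2) by (auto simp: grid_def)
  let ?a = "a - x" and ?b = "b - x - y" and ?c = "c - y"
  have abc: "int a - int x = int ?a" "int b - int x - int y = int ?b" "int c - int y = int ?c" "?c \<le> ?b"
    using g assms(1) by (auto simp: of_nat_diff)
  define C where C: "C i j = (outer_coef0 (int ?a + \<sigma> I1 - int m - int ?b + 2 * int ?c) (int n + int ?c - int ?b) i (int j)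
        * BF_coef j (int m - int n + int ?b - 2 * int ?c + \<sigma> I2) (int m - int ?c))" for i j
  have fm: "Fm (int ?a - int i) (int ?b - int i - int j) (int ?c - int j) = fm a b c (x + i, y + j)" for i j
    unfolding fm_def abc(1-3)[symmetric] by (simp add: algebra_simps)
  have "Bmon \<sigma> act \<eta> (int ?a) (int ?b) (int ?c) = (\<Sum>i\<le>?a. \<Sum>j\<le>?c. C i j \<star> fm a b c (x + i, y + j))"
    by (simp only: Bmon_expansion[OF abc(4)] C fm)
  also have "\<dots> = (\<Sum>h\<in>{..?a} \<times> {..?c}. C (fst h) (snd h) \<star> fm a b c (x + fst h, y + snd h))"
    by (simp add: sum.cartesian_product split_def)
  also have "\<dots> = C 0 0 \<star> fm a b c g + (\<Sum>h\<in>{..?a} \<times> {..?c} - {(0, 0)}. C (fst h) (snd h) \<star> fm a b c (x + fst h, y + snd h))"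
    by (subst sum.remove[of _ "(0, 0)"]) (simp_all add: g)
  also have "C 0 0 = 1" by (simp add: C outer_coef0_def qbinom_def numeral_2_eq_2)
  finally have "Bmon \<sigma> act \<eta> (int ?a) (int ?b) (int ?c) - fm a b c g
     = (\<Sum>h\<in>{..?a} \<times> {..?c} - {(0, 0)}. C (fst h) (snd h) \<star> fm a b c (x + fst h, y + snd h))"
    by simp
  also have "\<dots> \<in> vs.span (fm a b c ` {h \<in> grid a c. deg h > deg g})"
    by (intro vs.span_sum vs.span_scale vs.span_base imageI) (use g in \<open>auto simp: grid_def\<close>)
  finally show ?thesis by (simp only: abc g fst_conv snd_conv)
qed

lemma \<psi>L_span:
  assumes "\<And>g. g \<in> S \<Longrightarrow> \<psi>L (f g) \<in> vs.span T" "w \<in> vs.span (f ` S)"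
  shows "\<psi>L w \<in> vs.span T"
  using assms(2)
proof (induction rule: vs.span_induct_alt)
  case (step c x y)
  then show ?case using assms(1) by (auto simp: \<psi>L_add \<psi>L_vscale intro!: vs.span_add vs.span_scale)
qed (simp add: vs.span_zero)

text \<open>Downward induction on the degree. The B-monomial \<open>?B\<close> is invariant, so the
  difference equals \<open>(?B - fm) - \<psi>L (?B - fm)\<close>, and \<open>?B - fm\<close>
  involves larger degrees only.\<close>

lemma \<psi>L_fm:
  assumes "a + c \<le> b" "g \<in> grid a c"
  shows "\<psi>L (fm a b c g) - fm a b c g \<in> vs.span (fm a b c ` {h \<in> grid a c. deg h > deg g})"
  using assms(2)
proof (induction "a + c - deg g" arbitrary: g rule: less_induct)
  case less
  let ?U = "\<lambda>g. fm a b c ` {h \<in> grid a c. deg h > deg g}"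
  let ?B = "Bmon \<sigma> act \<eta> (int a - int (fst g)) (int b - int (fst g) - int (snd g)) (int c - int (snd g))"
  have R: "?B - fm a b c g \<in> vs.span (?U g)" by (rule Bmon_fm[OF assms(1) less.prems])
  have "\<psi>L (?B - fm a b c g) \<in> vs.span (?U g)"
  proof (rule \<psi>L_span[OF _ R])
    fix h assume h: "h \<in> {h \<in> grid a c. deg h > deg g}"
    then have "deg h \<le> a + c" by (auto simp: grid_def)
    then have "\<psi>L (fm a b c h) - fm a b c h \<in> vs.span (?U h)" using h less.hyps[of h] by auto
    also have "\<dots> \<subseteq> vs.span (?U g)" using h by (intro vs.span_mono) auto
    finally have 1: "\<psi>L (fm a b c h) - fm a b c h \<in> vs.span (?U g)" .
    have "fm a b c h \<in> vs.span (?U g)" using h by (intro vs.span_base) auto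
    from vs.span_add[OF 1 this] show "\<psi>L (fm a b c h) \<in> vs.span (?U g)" by simp
  qed
  with R have "(?B - fm a b c g) - \<psi>L (?B - fm a b c g) \<in> vs.span (?U g)" by (rule vs.span_diff)
  then show ?case by (simp add: \<psi>L_diff \<psi>L_Bmon)
qed

text \<open>Once the coefficients of smaller degree are 0, comparison modulo larger degrees gives
  \<open>qbar (p g) = p g\<close>, which forces an element of \<open>qinv_Z\<close> to be 0.\<close>

lemma \<psi>L_invariant_eq_0:
  assumes "a + c \<le> b" "c \<le> m" "b \<le> n + c"
    and p: "\<And>g. g \<in> grid a c \<Longrightarrow> p g \<in> qinv_Z"
    and inv: "\<psi>L (\<Sum>g\<in>grid a c. p g \<star> fm a b c g) = (\<Sum>g\<in>grid a c. p g \<star> fm a b c g)"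
    and "g \<in> grid a c"
  shows "p g = 0"
  using assms(6)
proof (induction "deg g" arbitrary: g rule: less_induct)
  case less
  define t where "t = deg g"
  let ?f = "fm a b c" and ?G = "grid a c"
  let ?U = "{h \<in> ?G. deg h > t}"
  have "\<psi>L (p h \<star> ?f h) - qbar (p h) \<star> ?f h \<in> vs.span (?f ` ?U)" if h: "h \<in> ?G" for h
  proof (cases "deg h < t")
    case True
    then have "p h = 0" using less.hyps h by (simp add: t_def)
    then show ?thesis by (simp add: vs.span_zero)
  next
    case False
    have "\<psi>L (?f h) - ?f h \<in> vs.span (?f ` {h' \<in> ?G. deg h' > deg h})"
      by (rule \<psi>L_fm[OF assms(1) h])
    also have "\<dots> \<subseteq> vs.span (?f ` ?U)" using False by (intro vs.span_mono) auto
    finally have "qbar (p h) \<star> (\<psi>L (?f h) - ?f h) \<in> vs.span (?f ` ?U)" by (rule vs.span_scale)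
    then show ?thesis by (simp add: \<psi>L_vscale vs.scale_right_diff_distrib)
  qed
  then have "(\<Sum>h\<in>?G. \<psi>L (p h \<star> ?f h) - qbar (p h) \<star> ?f h) \<in> vs.span (?f ` ?U)"
    by (rule vs.span_sum)
  also have "(\<Sum>h\<in>?G. \<psi>L (p h \<star> ?f h) - qbar (p h) \<star> ?f h) = (\<Sum>h\<in>?G. (p h - qbar (p h)) \<star> ?f h)"
    using inv by (simp add: \<psi>L_sum sum_subtractf vs.scale_left_diff_distrib)
  finally obtain r where r: "(\<Sum>h\<in>?G. (p h - qbar (p h)) \<star> ?f h) = (\<Sum>h\<in>?U. r h \<star> ?f h)"
    by (rule span_image_finite[rotated]) simp_all
  also have "(\<Sum>h\<in>?U. r h \<star> ?f h) = (\<Sum>h\<in>?G. (if deg h > t then r h else 0) \<star> ?f h)"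
    by (rule sum.mono_neutral_cong_left) auto
  finally have "(\<Sum>h\<in>?G. (p h - qbar (p h) - (if deg h > t then r h else 0)) \<star> ?f h) = 0"
    by (simp add: vs.scale_left_diff_distrib[of "_ - _"] sum_subtractf)
  from fm_independent[OF assms(1-3) this less.prems] have "qbar (p g) = p g"
    by (simp add: t_def)
  then show ?case using qinv_Z_bar_invariant p less.prems by blast
qed

text \<open>Two invariant elements of the coset differ by an invariant combination with all
  coefficients in \<open>qinv_Z\<close>, hence by 0.\<close>

lemma icb2_eqI:
  assumes "a + c \<le> b" "c \<le> m" "b \<le> n + c"
    and "\<psi>L v = v" "\<And>g. g \<in> grid a c \<Longrightarrow> g \<noteq> (0, 0) \<Longrightarrow> p g \<in> qinv_Z" "p (0, 0) = 1"
    and "v = (\<Sum>g\<in>grid a c. p g \<star> fm a b c g)"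
  shows "icb2 act \<eta> \<psi>L (int a) (int b) (int c) = v"
  unfolding icb2_def
proof (rule the_equality)
  have "(\<Sum>g\<in>grid a c. (if g = (0, 0) then 1 else 0) \<star> fm a b c g) = fm a b c (0, 0)"
    by (simp add: if_distrib[of "\<lambda>c. c \<star> _"] sum.delta grid_def cong: if_cong)
  note delta = this
  have v: "v = fm a b c (0, 0) + (\<Sum>g\<in>grid a c. (if g = (0, 0) then 0 else p g) \<star> fm a b c g)"
  proof -
    have "v = (\<Sum>g\<in>grid a c. ((if g = (0, 0) then 1 else 0) + (if g = (0, 0) then 0 else p g)) \<star> fm a b c g)"
      unfolding assms(7) by (rule sum.cong) (auto simp: assms(6))
    then show ?thesis
      unfolding vs.scale_left_distrib sum.distrib delta .
  qed
  have "v \<in> icb2_coset act \<eta> (int a) (int b) (int c)"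
    unfolding icb2_coset_iff[OF assms(1)]
    by (rule exI[of _ "\<lambda>g. if g = (0, 0) then 0 else p g"]) (use assms(5) v in auto)
  then show "v \<in> icb2_coset act \<eta> (int a) (int b) (int c) \<and> \<psi>L v = v" using assms(4) by simp
  fix w assume w: "w \<in> icb2_coset act \<eta> (int a) (int b) (int c) \<and> \<psi>L w = w"
  then obtain r where r: "\<forall>g\<in>grid a c. r g \<in> qinv_Z"
    and w': "w = fm a b c (0, 0) + (\<Sum>g\<in>grid a c. r g \<star> fm a b c g)"
    unfolding icb2_coset_iff[OF assms(1)] by blast
  define d where "d g = r g - (if g = (0, 0) then 0 else p g)" for g
  have wv: "w - v = (\<Sum>g\<in>grid a c. d g \<star> fm a b c g)"
    unfolding w' v d_def vs.scale_left_diff_distrib sum_subtractf by simp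
  have "d g = 0" if "g \<in> grid a c" for g
  proof (rule \<psi>L_invariant_eq_0[OF assms(1-3) _ _ that])
    show "d g \<in> qinv_Z" if "g \<in> grid a c" for g
      using r that assms(5)[OF that] qinv_Z_add[OF _ qinv_Z_uminus, of "r g" "p g"] by (auto simp: d_def)
    show "\<psi>L (\<Sum>g\<in>grid a c. d g \<star> fm a b c g) = (\<Sum>g\<in>grid a c. d g \<star> fm a b c g)"
      using w assms(4) by (simp add: \<psi>L_diff flip: wv)
  qed
  then have "w - v = 0" unfolding wv by simp
  then show "w = v" by simp
qed

end

section \<open>The i-canonical basis in terms of the B-monomials\<close>

lemma sum_triangle:
  fixes f :: "nat \<Rightarrow> nat \<Rightarrow> 'a::comm_monoid_add"
  shows "(\<Sum>l\<le>c. \<Sum>j\<le>c - l. f l (l + j)) = (\<Sum>j\<le>c. \<Sum>l\<le>j. f l j)"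
proof -
  have "(\<Sum>l\<le>c. \<Sum>j\<le>c - l. f l (l + j)) = (\<Sum>(l, j)\<in>(SIGMA l:{..c}. {..c - l}). f l (l + j))"
    by (rule sum.Sigma) auto
  also have "(SIGMA l:{..c}. {..c - l}) = {(l, j). l + j \<le> c}" by auto
  also have "(\<Sum>(l, j)\<in>{(l, j). l + j \<le> c}. f l (l + j)) = (\<Sum>j\<le>c. \<Sum>l\<le>j. f l j)"
    by (subst sum.triangle_reindex_eq) simp
  finally show ?thesis .
qed

lemma Ui_power: "x \<in> Ui \<sigma> \<Longrightarrow> x ^ n \<in> Ui \<sigma>"
  by (induction n) (simp_all add: Ui.one Ui.mult)

lemma Ui_zero: "0 \<in> Ui \<sigma>"
  using Ui.scale[where c = 0, OF Ui.one] by simp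

lemma udivpow_Ui: "x \<in> Ui \<sigma> \<Longrightarrow> udivpow x r \<in> Ui \<sigma>"
  by (simp add: divpow_def Ui_zero Ui.scale Ui_power)

text \<open>Quantum factorials are bar-invariant, so divided powers of fixed elements are
  fixed.\<close>

lemma psi_i_udivpow:
  assumes "is_psi_i \<sigma> \<psi>" "x \<in> Ui \<sigma>" "\<psi> x = x"
  shows "\<psi> (udivpow x r) = udivpow x r"
proof -
  have scale: "\<psi> (d \<cdot>\<^sub>U y) = qbar d \<cdot>\<^sub>U \<psi> y" and mult: "\<psi> (y * z) = \<psi> y * \<psi> z" and one: "\<psi> 1 = 1"
    if "y \<in> Ui \<sigma>" "z \<in> Ui \<sigma>" for d y z
    using assms(1) that by (auto simp: is_psi_i_def)
  have pow: "\<psi> (x ^ n) = x ^ n" for n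
    using assms(2,3) by (induction n) (simp_all add: one[OF Ui.one Ui.one] mult Ui_power)
  have "\<psi> 0 = 0" using scale[OF Ui.one Ui.one, of 0] by simp
  then show ?thesis
    using assms(2) by (simp add: divpow_def scale[OF Ui_power Ui.one] pow qbar_inverse)
qed

lemma bar_L_moduleI:
  assumes "L_module act m n \<eta>" "is_psi_i \<sigma> \<psi>" "is_psi_L \<sigma> act \<eta> \<psi> \<psi>L"
  shows "bar_L_module act m n \<eta> \<sigma> \<psi>L"
proof -
  interpret L_module act m n \<eta> by (rule assms(1))
  have fixed: "\<psi> (B \<sigma> i) = B \<sigma> i" and mult: "y \<in> Ui \<sigma> \<Longrightarrow> z \<in> Ui \<sigma> \<Longrightarrow> \<psi> (y * z) = \<psi> y * \<psi> z" for i y z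
    using assms(2) by (auto simp: is_psi_i_def)
  show ?thesis
  proof
    fix x y z
    let ?u = "udivpow (B \<sigma> I1) x * udivpow (B \<sigma> I2) y * udivpow (B \<sigma> I1) z"
    have Ui: "udivpow (B \<sigma> i) r \<in> Ui \<sigma>" for i r by (rule udivpow_Ui[OF Ui.B])
    have "\<psi> ?u = ?u"
      by (simp add: mult Ui Ui.mult psi_i_udivpow[OF assms(2) Ui.B fixed])
    moreover have "?u \<in> Ui \<sigma>" by (intro Ui.mult Ui)
    ultimately show "\<psi>L (Bmon \<sigma> act \<eta> x y z) = Bmon \<sigma> act \<eta> x y z"
      using assms(3) by (simp add: Bmon_def is_psi_L_def)
  qed (use assms(3) in \<open>auto simp: is_psi_L_def\<close>)
qed

context bar_L_module
begin

abbreviation Bm :: "int \<Rightarrow> int \<Rightarrow> int \<Rightarrow> 'v" where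
  "Bm \<equiv> Bmon \<sigma> act \<eta>"

definition \<alpha> :: "nat \<Rightarrow> nat \<Rightarrow> int" where
  "\<alpha> b c = int m - int n + int b - 2 * int c + \<sigma> I2"

definition outer_coef :: "nat \<Rightarrow> nat \<Rightarrow> nat \<Rightarrow> nat \<Rightarrow> nat \<Rightarrow> Qq" where
  "outer_coef a b c i j = outer_coef0 (int a + \<sigma> I1 - int m - int b + 2 * int c) (int n + int c - int b) i (int j)"

lemma
  assumes "l \<le> c" "c \<le> b"
  shows \<alpha>_diff: "\<alpha> (b - l) (c - l) = \<alpha> b c + int l"
    and outer_coef_diff: "outer_coef a (b - l) (c - l) i j = outer_coef a b c i (l + j)"
  using assms by (simp_all add: \<alpha>_def outer_coef_def outer_coef0_def of_nat_diff algebra_simps)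

lemma Bmon_expansion_shift:
  assumes "l \<le> c" "c \<le> b"
  shows "Bm (int a) (int b - int l) (int c - int l)
    = (\<Sum>i\<le>a. \<Sum>j\<le>c - l. (outer_coef a b c i (l + j) * BF_coef j (\<alpha> b c + int l) (int m - int c + int l))
        \<star> fm a b c (i, l + j))"
proof -
  have e: "int b - int l = int (b - l)" "int c - int l = int (c - l)" "int m - int (c - l) = int m - int c + int l" "c - l \<le> b - l"
    using assms by (simp_all add: of_nat_diff)
  have fm: "Fm (int a - int i) (int (b - l) - int i - int j) (int (c - l) - int j) = fm a b c (i, l + j)" for i j
    by (simp add: fm_def algebra_simps flip: e(1,2))
  show ?thesis
    unfolding e(1,2) Bmon_expansion[OF e(4)] fm e(3) \<alpha>_def[symmetric] outer_coef_def[symmetric] \<alpha>_diff[OF assms] outer_coef_diff[OF assms] ..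
qed

text \<open>\<open>outer_coef\<close> depends on the total displacement alone and comes out of the
  sum over \<open>l\<close>, which leaves \<open>icbF_coef\<close>.\<close>

lemma sum_icbB_coef_Bmon:
  assumes "c \<le> b"
  shows "(\<Sum>l\<le>c. icbB_coef (\<alpha> b c) l \<star> Bm (int a) (int b - int l) (int c - int l))
    = (\<Sum>g\<in>grid a c. (outer_coef a b c (fst g) (snd g) * icbF_coef (snd g) (\<alpha> b c) (int m - int c)) \<star> fm a b c g)"
proof -
  let ?t = "\<lambda>i l j. (outer_coef a b c i j * (icbB_coef (\<alpha> b c) l * BF_coef (j - l) (\<alpha> b c + int l) (int m - int c + int l))) \<star> fm a b c (i, j)"
  have "(\<Sum>l\<le>c. icbB_coef (\<alpha> b c) l \<star> Bm (int a) (int b - int l) (int c - int l))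
    = (\<Sum>l\<le>c. \<Sum>i\<le>a. \<Sum>j\<le>c - l. ?t i l (l + j))"
    by (rule sum.cong)
       (simp_all add: Bmon_expansion_shift assms vs.scale_sum_right mult.left_commute)
  also have "\<dots> = (\<Sum>i\<le>a. \<Sum>l\<le>c. \<Sum>j\<le>c - l. ?t i l (l + j))"
    by (rule sum.swap)
  also have "\<dots> = (\<Sum>i\<le>a. \<Sum>j\<le>c. \<Sum>l\<le>j. ?t i l j)"
  proof -
    have "(\<Sum>l\<le>c. \<Sum>j\<le>c - l. ?t i l (l + j)) = (\<Sum>j\<le>c. \<Sum>l\<le>j. ?t i l j)" for i
      by (rule sum_triangle[of "?t i"])
    then show ?thesis by (simp only:)
  qed
  also have "\<dots> = (\<Sum>i\<le>a. \<Sum>j\<le>c. (outer_coef a b c i j * icbF_coef j (\<alpha> b c) (int m - int c)) \<star> fm a b c (i, j))"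
    by (simp only: icbF_coef_def sum_distrib_left vs.scale_sum_left)
  also have "\<dots> = (\<Sum>g\<in>grid a c. (outer_coef a b c (fst g) (snd g) * icbF_coef (snd g) (\<alpha> b c) (int m - int c)) \<star> fm a b c g)"
    by (simp add: grid_def sum.cartesian_product split_def)
  finally show ?thesis .
qed

lemma outer_coef_0 [simp]: "outer_coef a b c 0 j = 1"
  by (simp add: outer_coef_def outer_coef0_def qbinom_def numeral_2_eq_2)

context
  assumes \<sigma>: "\<sigma> I1 + \<sigma> I2 = 1" "\<sigma> I2 \<le> 1"
begin

text \<open>The binomial reaches at most \<open>q^(i * ?N)\<close>. Together with the explicit power
  this gives \<open>i\<close> times \<open>(1 - \<alpha>) - (b - a - c) - j\<close>, which is
  negative, minus a binomial coefficient.\<close>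

lemma outer_coef_qinv:
  assumes "a + c < b" "b \<le> n + c" "\<alpha> b c > 0" "i > 0"
  shows "outer_coef a b c i j \<in> qinv_Z"
proof -
  let ?N = "int n + int c - int b"
  let ?e = "int a + \<sigma> I1 - int m - int b + 2 * int c"
  have "?e - int j + ?N = (1 - \<alpha> b c) - (int b - int a - int c) - int j"
    using \<sigma>(1) by (simp add: \<alpha>_def)
  then have neg: "?e - int j + ?N < 0" using assms by simp
  have split: "int i * (?e - int j) - int (Suc i choose 2) = (int i * (?e - int j + ?N) - int (Suc i choose 2)) + (- (int i * ?N))"
    by (simp add: algebra_simps)
  have "int i * (?e - int j + ?N) < 0" using neg assms(4) by (simp add: mult_pos_neg)
  then have "q powi (int i * (?e - int j + ?N) - int (Suc i choose 2)) * (q powi (- (int i * ?N)) * qbinom ?N i) \<in> qinv_Z"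
    using assms(2) by (intro qinv_Z_powi_mult qbinom_Zqinv) auto
  then show ?thesis
    unfolding outer_coef_def outer_coef0_def split q_powi_mult[symmetric] by (simp only: mult.assoc)
qed

text \<open>The coefficients \<open>icbB_coef\<close> are bar-invariant, hence so is the sum, and
  its F-expansion satisfies \<open>icb2_eqI\<close>. Both parities of \<alpha> are covered.\<close>

lemma icb2_eq_sum_Bmon:
  assumes "c \<le> m" "b \<le> n + c" "a + c < b" "\<alpha> b c > 0"
  shows "icb2 act \<eta> \<psi>L (int a) (int b) (int c)
    = (\<Sum>l\<le>c. icbB_coef (\<alpha> b c) l \<star> Bm (int a) (int b - int l) (int c - int l))"
proof (rule icb2_eqI)
  let ?p = "\<lambda>g. outer_coef a b c (fst g) (snd g) * icbF_coef (snd g) (\<alpha> b c) (int m - int c)"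
  \<comment> \<open>The two sides differ by \<open>n + c - b + 1 - \<sigma> I2\<close>.\<close>
  have M: "int m - int c \<ge> \<alpha> b c - 1" using assms(2) \<sigma>(2) by (simp add: \<alpha>_def)
  show "a + c \<le> b" "c \<le> m" "b \<le> n + c" using assms by simp_all
  show "\<psi>L (\<Sum>l\<le>c. icbB_coef (\<alpha> b c) l \<star> Bm (int a) (int b - int l) (int c - int l))
    = (\<Sum>l\<le>c. icbB_coef (\<alpha> b c) l \<star> Bm (int a) (int b - int l) (int c - int l))"
    by (simp add: \<psi>L_sum \<psi>L_vscale \<psi>L_Bmon)
  show "?p g \<in> qinv_Z" if "g \<noteq> (0, 0)" for g
  proof (cases "fst g = 0")
    case True
    then have "snd g \<ge> 1" using that by (cases g) auto
    then show ?thesis using icbF_coef_qinv[OF _ M] assms(4) True by simp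
  next
    case False
    have "icbF_coef (snd g) (\<alpha> b c) (int m - int c) \<in> Zqinv"
      using icbF_coef_qinv[OF _ M, of "snd g"] assms(4) qinv_Z_subset by (cases "snd g = 0") auto
    then show ?thesis using outer_coef_qinv[OF assms(3,2,4)] False by (simp add: qinv_Z_mult)
  qed
  show "?p (0, 0) = 1" by simp
  show "(\<Sum>l\<le>c. icbB_coef (\<alpha> b c) l \<star> Bm (int a) (int b - int l) (int c - int l)) = (\<Sum>g\<in>grid a c. ?p g \<star> fm a b c g)"
    using assms by (intro sum_icbB_coef_Bmon) simp
qed

text \<open>\<open>icb2_eq_sum_Bmon\<close> applies to every \<open>(b - k, c - k)\<close>, since
  the bounds persist and \<alpha> + k stays positive, though possibly even. The sum over
  \<open>k\<close> then collapses by \<open>BF_coef_expansion\<close>.\<close>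

lemma Bmon_eq_sum_icb2:
  assumes "c \<le> m" "b \<le> n + c" "a + c < b" "\<alpha> b c > 0" "odd (\<alpha> b c)"
  shows "Bm (int a) (int b) (int c)
    = (\<Sum>k\<le>c. Bicb_coef (\<alpha> b c) k \<star> icb2 act \<eta> \<psi>L (int a) (int b - int k) (int c - int k))"
proof -
  let ?\<alpha> = "\<alpha> b c" and ?M = "int m - int c"
  have M: "?M \<ge> ?\<alpha> - 1" using assms(2) \<sigma>(2) by (simp add: \<alpha>_def)
  have cb: "c \<le> b" using assms(3) by simp
  have icb: "icb2 act \<eta> \<psi>L (int a) (int b - int k) (int c - int k)
    = (\<Sum>i\<le>a. \<Sum>j\<le>c - k. (outer_coef a b c i (k + j) * icbF_coef j (?\<alpha> + int k) (?M + int k)) \<star> fm a b c (i, k + j))"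
    if k: "k \<le> c" for k
  proof -
    have e: "int b - int k = int (b - k)" "int c - int k = int (c - k)" "int m - int (c - k) = ?M + int k"
      using k cb by (simp_all add: of_nat_diff)
    have fm: "fm a (b - k) (c - k) (i, j) = fm a b c (i, k + j)" for i j
      by (simp add: fm_def algebra_simps flip: e(1,2))
    have "icb2 act \<eta> \<psi>L (int a) (int (b - k)) (int (c - k))
      = (\<Sum>g\<in>grid a (c - k). (outer_coef a (b - k) (c - k) (fst g) (snd g) * icbF_coef (snd g) (\<alpha> (b - k) (c - k)) (int m - int (c - k)))
           \<star> fm a (b - k) (c - k) g)"
      using k assms \<alpha>_diff[OF k cb]
      by (subst icb2_eq_sum_Bmon; (subst sum_icbB_coef_Bmon)?) auto
    then show ?thesis
      unfolding e(1,2) by (simp add: grid_def \<alpha>_diff[OF k cb] outer_coef_diff[OF k cb] e(3) sum.cartesian_product split_def flip: fm)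
  qed
  let ?t = "\<lambda>i k j. (outer_coef a b c i j * (Bicb_coef ?\<alpha> k * icbF_coef (j - k) (?\<alpha> + int k) (?M + int k))) \<star> fm a b c (i, j)"
  have "(\<Sum>k\<le>c. Bicb_coef ?\<alpha> k \<star> icb2 act \<eta> \<psi>L (int a) (int b - int k) (int c - int k))
    = (\<Sum>k\<le>c. \<Sum>i\<le>a. \<Sum>j\<le>c - k. ?t i k (k + j))"
    by (rule sum.cong) (simp_all add: icb vs.scale_sum_right mult.left_commute)
  also have "\<dots> = (\<Sum>i\<le>a. \<Sum>k\<le>c. \<Sum>j\<le>c - k. ?t i k (k + j))"
    by (rule sum.swap)
  also have "\<dots> = (\<Sum>i\<le>a. \<Sum>j\<le>c. \<Sum>k\<le>j. ?t i k j)"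
  proof -
    have "(\<Sum>k\<le>c. \<Sum>j\<le>c - k. ?t i k (k + j)) = (\<Sum>j\<le>c. \<Sum>k\<le>j. ?t i k j)" for i
      by (rule sum_triangle[of "?t i"])
    then show ?thesis by (simp only:)
  qed
  also have "\<dots> = (\<Sum>i\<le>a. \<Sum>j\<le>c. (outer_coef a b c i j * BF_coef j ?\<alpha> ?M) \<star> fm a b c (i, j))"
    by (simp only: BF_coef_expansion[OF assms(5) M] sum_distrib_left vs.scale_sum_left)
  also have "\<dots> = Bm (int a) (int b) (int c)"
    using Bmon_expansion_shift[of 0 c b a] cb by simp
  finally show ?thesis by simp
qed

end

end

lemma qdots_Bicb_coef:
  "odd k \<Longrightarrow> qint \<alpha> * (qdots (\<alpha> - int k + 2) (\<alpha> + int k - 2) / qfact k) = Bicb_coef \<alpha> k"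
  "even k \<Longrightarrow> qdots (\<alpha> - int k + 1) (\<alpha> + int k - 1) / qfact k = Bicb_coef \<alpha> k"
proof -
  assume k: "odd k"
  then have "\<alpha> + int k - 2 = (\<alpha> - int k + 2) + 2 * int (k - 1) - 2"
    using odd_pos[OF k] by (simp add: of_nat_diff)
  then show "qint \<alpha> * (qdots (\<alpha> - int k + 2) (\<alpha> + int k - 2) / qfact k) = Bicb_coef \<alpha> k"
    using k by (simp only: qdots_eq_qrise2 Bicb_coef_def if_True not_False_eq_True)
next
  assume k: "even k"
  have "\<alpha> + int k - 1 = (\<alpha> - int k + 1) + 2 * int k - 2" by simp
  then have "qdots (\<alpha> - int k + 1) (\<alpha> + int k - 1) = qrise2 (\<alpha> - int k + 1) k"
    by (simp only: qdots_eq_qrise2)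
  then show "qdots (\<alpha> - int k + 1) (\<alpha> + int k - 1) / qfact k = Bicb_coef \<alpha> k"
    using k by (simp add: Bicb_coef_def)
qed

text \<open>For \<open>k = 0\<close> both sides are 1 by convention; otherwise the dotted product
  has \<open>k - 1\<close> factors.\<close>

lemma qdots_icbB_coef:
  assumes "odd \<alpha>"
  shows "(if k = 0 then 1 else (- 1) ^ k * qint (\<alpha> + int k - 1)
     * (qdots (\<alpha> + 1) (\<alpha> + 2 * int k - 3) / qfact k)) = icbB_coef \<alpha> k"
proof (cases "k = 0")
  case False
  then have "\<alpha> + 2 * int k - 3 = (\<alpha> + 1) + 2 * int (k - 1) - 2" by (simp add: of_nat_diff)
  then have "qdots (\<alpha> + 1) (\<alpha> + 2 * int k - 3) = qrise2 (\<alpha> + 1) (k - 1)"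
    by (simp only: qdots_eq_qrise2)
  then show ?thesis using assms False by (simp add: icbB_coef_def)
qed (simp add: icbB_coef_def)

theorem theorem6p5:
  fixes act :: "uqsl3 \<Rightarrow> 'v::ab_group_add \<Rightarrow> 'v"
    and \<eta> :: 'v and \<psi> :: "uqsl3 \<Rightarrow> uqsl3" and \<psi>L :: "'v \<Rightarrow> 'v"
    and \<sigma> :: "idx \<Rightarrow> int" and m n a b c :: nat and \<alpha> :: int
  assumes "L_module act m n \<eta>"
    and "(\<sigma> I1, \<sigma> I2) \<in> {(1, 0), (0, 1)}"
    and "is_psi_i \<sigma> \<psi>"
    and "is_psi_L \<sigma> act \<eta> \<psi> \<psi>L"
    and "m \<ge> c" and "int n - int b + int c \<ge> 0"
    and "\<alpha> = int m - int n + int b - 2 * int c + \<sigma> I2"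
    and "\<alpha> > 0" and "odd \<alpha>" and "b > a + c"
  shows
    "(Bmon \<sigma> act \<eta> (int a) (int b) (int c) =
       vscale act (qint \<alpha>)
         (\<Sum>k \<in> {k \<in> {0..c}. odd k}.
            vscale act (qdots (\<alpha> - int k + 2) (\<alpha> + int k - 2) / qfact k)
              (icb2 act \<eta> \<psi>L (int a) (int b - int k) (int c - int k)))
       + (\<Sum>k \<in> {k \<in> {0..c}. even k}.
            vscale act (qdots (\<alpha> - int k + 1) (\<alpha> + int k - 1) / qfact k)
              (icb2 act \<eta> \<psi>L (int a) (int b - int k) (int c - int k))))
     \<and>
     (icb2 act \<eta> \<psi>L (int a) (int b) (int c) =
       (\<Sum>k = 0..c.
          vscale act
            (if k = 0 then 1
             else (- 1) ^ k * qint (\<alpha> + int k - 1)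
                    * (qdots (\<alpha> + 1) (\<alpha> + 2 * int k - 3) / qfact k))
            (Bmon \<sigma> act \<eta> (int a) (int b - int k) (int c - int k))))"
proof -
  interpret bar_L_module act m n \<eta> \<sigma> \<psi>L
    using assms(1,3,4) by (rule bar_L_moduleI)
  have \<sigma>: "\<sigma> I1 + \<sigma> I2 = 1" "\<sigma> I2 \<le> 1" using assms(2) by auto
  have \<alpha>: "bar_L_module.\<alpha> m n \<sigma> b c = \<alpha>" using assms(7) by (simp add: \<alpha>_def)
  have bn: "b \<le> n + c" using assms(6) by linarith
  let ?i = "\<lambda>k. icb2 act \<eta> \<psi>L (int a) (int b - int k) (int c - int k)"
  have "Bmon \<sigma> act \<eta> (int a) (int b) (int c) = (\<Sum>k\<le>c. Bicb_coef \<alpha> k \<star> ?i k)"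
    using Bmon_eq_sum_icb2[OF \<sigma> assms(5) bn assms(10)] assms(8,9) by (simp add: \<alpha>)
  also have "\<dots> = (\<Sum>k | k \<le> c \<and> odd k. Bicb_coef \<alpha> k \<star> ?i k) + (\<Sum>k | k \<le> c \<and> even k. Bicb_coef \<alpha> k \<star> ?i k)"
    by (subst sum.union_disjoint[symmetric]) (auto intro: sum.cong)
  also have "(\<Sum>k | k \<le> c \<and> odd k. Bicb_coef \<alpha> k \<star> ?i k) = qint \<alpha> \<star> (\<Sum>k \<in> {k \<in> {0..c}. odd k}.
       (qdots (\<alpha> - int k + 2) (\<alpha> + int k - 2) / qfact k) \<star> ?i k)"
    unfolding vs.scale_sum_right vs.scale_scale
    by (rule sum.cong) (auto simp: qdots_Bicb_coef(1)[symmetric])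
  also have "(\<Sum>k | k \<le> c \<and> even k. Bicb_coef \<alpha> k \<star> ?i k) = (\<Sum>k \<in> {k \<in> {0..c}. even k}.
       (qdots (\<alpha> - int k + 1) (\<alpha> + int k - 1) / qfact k) \<star> ?i k)"
    by (rule sum.cong) (auto simp: qdots_Bicb_coef(2)[symmetric])
  finally have 1: "Bmon \<sigma> act \<eta> (int a) (int b) (int c) =
      qint \<alpha> \<star> (\<Sum>k \<in> {k \<in> {0..c}. odd k}. (qdots (\<alpha> - int k + 2) (\<alpha> + int k - 2) / qfact k) \<star> ?i k)
      + (\<Sum>k \<in> {k \<in> {0..c}. even k}. (qdots (\<alpha> - int k + 1) (\<alpha> + int k - 1) / qfact k) \<star> ?i k)" .
  have 2: "icb2 act \<eta> \<psi>L (int a) (int b) (int c) = (\<Sum>k = 0..c. icbB_coef \<alpha> k \<star> Bm (int a) (int b - int k) (int c - int k))"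
    using icb2_eq_sum_Bmon[OF \<sigma> assms(5) bn assms(10)] assms(8) by (simp add: \<alpha> atMost_atLeast0)
  show ?thesis
    unfolding qdots_icbB_coef[OF assms(9)] by (rule conjI[OF 1 2])
qed

end
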